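(* Let $\varphi$ be a negative formula (containing neither $\exists$ nor $\lor$) of the language of geometry without Skolem functions. If classical Tarski geometry without Skolem functions proves $\varphi$, then intuitionistic Tarski geometry proves $\varphi$.
   Context: One sort of variables (points); 4-ary congruence $E(a,b,c,d)$ written $ab=cd$; strict betweenness $B$ and non-strict betweenness $T$ are interdefinable by $T(a,b,c):=\neg(a\neq b\land b\neq c\land\neg B(a,b,c))$ and $B(a,b,c):=T(a,b,c)\land a\neq b\land b\neq c$; formulas are read in either language via these definitions. $Col(a,b,c):=\neg(\neg T(c,a,b)\land\neg T(a,c,b)\land\neg T(a,b,c))$. Axioms are universally closed. Intuitionistic Tarski geometry (primitive $B$, $E$, intuitionistic predicate logic with equality) has the axioms: (A1) $ab=ba$; (A2) $ab=pq\land ab=rs\to pq=rs$; (A3) $ab=cc\to a=b$; (A4-i) $q\neq a\to\exists x(T(q,a,x)\land ax=bc)$; (A5) $a\neq b\land T(a,b,c)\land T(A,B,C)\land ab=AB\land bc=BC\land ad=AD\land bd=BD\to cd=CD$; (A6-i) $\neg B(a,b,a)$; (A7-i) $B(a,p,c)\land T(b,q,c)\land\neg Col(a,b,c)\to\exists x(T(p,x,b)\land T(q,x,a))$; (A8) $\exists a,b,c\,\neg Col(a,b,c)$; (A9) $a\neq b\land pa=pb\land qa=qb\land ra=rb\to Col(p,q,r)$; (A10$_3$) $\neg Col(a,b,c)\to\exists x(ax=bx\land ax=cx)$; (A14-i) $B(a,b,c)\to B(c,b,a)$; (A15-i) $B(a,b,d)\land B(b,c,d)\to B(a,b,c)$;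 two-point line-circle: $Col(u,v,p)\land u\neq v\land T(a,p,b)\to\exists y,z(Col(u,v,y)\land Col(u,v,z)\land ay=ab\land az=ab\land T(y,p,z)\land(p\neq b\to y\neq z))$; stability: $\neg\neg B(a,b,c)\to B(a,b,c)$, $\neg\neg ab=cd\to ab=cd$, $\neg a\neq b\to a=b$. Classical Tarski geometry (primitive $T$, $E$, classical logic) has the axioms (A1), (A2), (A3), (A5), (A8), (A9), (A10$_3$) above together with (A4) $\exists x(T(q,a,x)\land ax=bc)$; (A6) $T(a,b,a)\to a=b$; (A7) $T(a,p,c)\land T(b,q,c)\to\exists x(T(p,x,b)\land T(q,x,a))$; and segment-circle continuity $ax=ap\land T(a,x,b)\land T(a,b,y)\land ay=aq\to\exists z(T(p,z,q)\land az=ab)$. *)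

theory Defs
  imports Main
begin

section \<open>First-order formulas of geometry\<close>

text \<open>
  The language has one sort, equality, a 4-ary congruence, and ternary betweenness symbols drawn
  from the type parameter, which is therefore what distinguishes the languages below. There are no
  function symbols, so terms are variables. Variables are de Bruijn indices (0 refers to the
  innermost quantifier), and substitution is renaming of free variables.
\<close>

datatype 'b fm =
    Falsum  (\<open>\<^bold>\<bottom>\<close>)
  | Eql nat nat  (infix \<open>\<^bold>=\<close> 50)
  | Betw 'b nat nat nat
  | Cong nat nat nat nat
  | Con "'b fm" "'b fm"  (infixr \<open>\<^bold>\<and>\<close> 35)
  | Dis "'b fm" "'b fm"  (infixr \<open>\<^bold>\<or>\<close> 30)
  | Imp "'b fm" "'b fm"  (infixr \<open>\<^bold>\<longrightarrow>\<close> 25)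
  | Uni "'b fm"
  | Exi "'b fm"

abbreviation Neg :: "'b fm \<Rightarrow> 'b fm"  (\<open>\<^bold>\<not> _\<close> [40] 40) where
  "\<^bold>\<not> \<phi> \<equiv> (\<phi> \<^bold>\<longrightarrow> \<^bold>\<bottom>)"

abbreviation Neq :: "nat \<Rightarrow> nat \<Rightarrow> 'b fm"  (infix \<open>\<^bold>\<noteq>\<close> 50) where
  "x \<^bold>\<noteq> y \<equiv> \<^bold>\<not> (x \<^bold>= y)"

primrec negative :: "'b fm \<Rightarrow> bool" where
  "negative \<^bold>\<bottom> \<longleftrightarrow> True"
| "negative (x \<^bold>= y) \<longleftrightarrow> True"
| "negative (Betw r x y z) \<longleftrightarrow> True"
| "negative (Cong x y z w) \<longleftrightarrow> True"
| "negative (\<phi> \<^bold>\<and> \<psi>) \<longleftrightarrow> negative \<phi> \<and> negative \<psi>"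
| "negative (\<phi> \<^bold>\<or> \<psi>) \<longleftrightarrow> False"
| "negative (\<phi> \<^bold>\<longrightarrow> \<psi>) \<longleftrightarrow> negative \<phi> \<and> negative \<psi>"
| "negative (Uni \<phi>) \<longleftrightarrow> negative \<phi>"
| "negative (Exi \<phi>) \<longleftrightarrow> False"

definition lift :: "(nat \<Rightarrow> nat) \<Rightarrow> nat \<Rightarrow> nat" where
  "lift f n = (case n of 0 \<Rightarrow> 0 | Suc m \<Rightarrow> Suc (f m))"

primrec ren :: "(nat \<Rightarrow> nat) \<Rightarrow> 'b fm \<Rightarrow> 'b fm" where
  "ren f \<^bold>\<bottom> = \<^bold>\<bottom>"
| "ren f (x \<^bold>= y) = (f x \<^bold>= f y)"
| "ren f (Betw r x y z) = Betw r (f x) (f y) (f z)"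
| "ren f (Cong x y z w) = Cong (f x) (f y) (f z) (f w)"
| "ren f (\<phi> \<^bold>\<and> \<psi>) = (ren f \<phi> \<^bold>\<and> ren f \<psi>)"
| "ren f (\<phi> \<^bold>\<or> \<psi>) = (ren f \<phi> \<^bold>\<or> ren f \<psi>)"
| "ren f (\<phi> \<^bold>\<longrightarrow> \<psi>) = (ren f \<phi> \<^bold>\<longrightarrow> ren f \<psi>)"
| "ren f (Uni \<phi>) = Uni (ren (lift f) \<phi>)"
| "ren f (Exi \<phi>) = Exi (ren (lift f) \<phi>)"

text \<open>\<open>inst x \<phi>\<close> is the body \<open>\<phi>\<close> of a quantifier with its bound variable replaced by \<open>x\<close>.\<close>

definition inst :: "nat \<Rightarrow> 'b fm \<Rightarrow> 'b fm" where
  "inst x \<phi> = ren (\<lambda>n. case n of 0 \<Rightarrow> x | Suc m \<Rightarrow> m) \<phi>"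


section \<open>Intuitionistic and classical predicate logic with equality\<close>

datatype logic = Intuitionistic | Classical

text \<open>
  Natural deduction from a possibly infinite set of hypotheses. In the rules with an eigenvariable,
  \<open>ren Suc\<close> frees the index 0, which serves as the fresh variable.
\<close>

inductive derives :: "logic \<Rightarrow> 'b fm set \<Rightarrow> 'b fm \<Rightarrow> bool" for L :: logic where
  Hyp:    "\<phi> \<in> \<Gamma> \<Longrightarrow> derives L \<Gamma> \<phi>"
| FalsumE: "derives L \<Gamma> \<^bold>\<bottom> \<Longrightarrow> derives L \<Gamma> \<phi>"
| ConI:   "derives L \<Gamma> \<phi> \<Longrightarrow> derives L \<Gamma> \<psi> \<Longrightarrow> derives L \<Gamma> (\<phi> \<^bold>\<and> \<psi>)"
| ConE1:  "derives L \<Gamma> (\<phi> \<^bold>\<and> \<psi>) \<Longrightarrow> derives L \<Gamma> \<phi>"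
| ConE2:  "derives L \<Gamma> (\<phi> \<^bold>\<and> \<psi>) \<Longrightarrow> derives L \<Gamma> \<psi>"
| DisI1:  "derives L \<Gamma> \<phi> \<Longrightarrow> derives L \<Gamma> (\<phi> \<^bold>\<or> \<psi>)"
| DisI2:  "derives L \<Gamma> \<psi> \<Longrightarrow> derives L \<Gamma> (\<phi> \<^bold>\<or> \<psi>)"
| DisE:   "derives L \<Gamma> (\<phi> \<^bold>\<or> \<psi>) \<Longrightarrow> derives L (insert \<phi> \<Gamma>) \<chi> \<Longrightarrow> derives L (insert \<psi> \<Gamma>) \<chi>
            \<Longrightarrow> derives L \<Gamma> \<chi>"
| ImpI:   "derives L (insert \<phi> \<Gamma>) \<psi> \<Longrightarrow> derives L \<Gamma> (\<phi> \<^bold>\<longrightarrow> \<psi>)"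
| ImpE:   "derives L \<Gamma> (\<phi> \<^bold>\<longrightarrow> \<psi>) \<Longrightarrow> derives L \<Gamma> \<phi> \<Longrightarrow> derives L \<Gamma> \<psi>"
| UniI:   "derives L (ren Suc ` \<Gamma>) \<phi> \<Longrightarrow> derives L \<Gamma> (Uni \<phi>)"
| UniE:   "derives L \<Gamma> (Uni \<phi>) \<Longrightarrow> derives L \<Gamma> (inst x \<phi>)"
| ExiI:   "derives L \<Gamma> (inst x \<phi>) \<Longrightarrow> derives L \<Gamma> (Exi \<phi>)"
| ExiE:   "derives L \<Gamma> (Exi \<phi>) \<Longrightarrow> derives L (insert \<phi> (ren Suc ` \<Gamma>)) (ren Suc \<chi>)
            \<Longrightarrow> derives L \<Gamma> \<chi>"
| EqlI:   "derives L \<Gamma> (x \<^bold>= x)"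
| EqlE:   "derives L \<Gamma> (x \<^bold>= y) \<Longrightarrow> derives L \<Gamma> (inst x \<phi>) \<Longrightarrow> derives L \<Gamma> (inst y \<phi>)"
| DNE:    "L = Classical \<Longrightarrow> derives L \<Gamma> (\<^bold>\<not> \<^bold>\<not> \<phi>) \<Longrightarrow> derives L \<Gamma> \<phi>"


section \<open>Strict and non-strict betweenness\<close>

text \<open>
  Formulas and axioms are written in a common notation that has both betweenness symbols. The
  languages with only strict, respectively only non-strict betweenness have their own types, and
  \<open>to_B\<close>, \<open>to_T\<close> read a formula in these languages by unfolding the definition of the symbol
  that is not primitive.
\<close>

datatype betweenness = Strict | Nonstrict
datatype strict = StrictOnly
datatype nonstrict = NonstrictOnly

abbreviation B :: "nat \<Rightarrow> nat \<Rightarrow> nat \<Rightarrow> betweenness fm" where "B \<equiv> Betw Strict"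
abbreviation T :: "nat \<Rightarrow> nat \<Rightarrow> nat \<Rightarrow> betweenness fm" where "T \<equiv> Betw Nonstrict"

text \<open>The definitions substituted for atoms are quantifier-free, so no capture can occur.\<close>

primrec expand :: "('b \<Rightarrow> nat \<Rightarrow> nat \<Rightarrow> nat \<Rightarrow> 'c fm) \<Rightarrow> 'b fm \<Rightarrow> 'c fm" where
  "expand d \<^bold>\<bottom> = \<^bold>\<bottom>"
| "expand d (x \<^bold>= y) = (x \<^bold>= y)"
| "expand d (Betw r x y z) = d r x y z"
| "expand d (Cong x y z w) = Cong x y z w"
| "expand d (\<phi> \<^bold>\<and> \<psi>) = (expand d \<phi> \<^bold>\<and> expand d \<psi>)"
| "expand d (\<phi> \<^bold>\<or> \<psi>) = (expand d \<phi> \<^bold>\<or> expand d \<psi>)"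
| "expand d (\<phi> \<^bold>\<longrightarrow> \<psi>) = (expand d \<phi> \<^bold>\<longrightarrow> expand d \<psi>)"
| "expand d (Uni \<phi>) = Uni (expand d \<phi>)"
| "expand d (Exi \<phi>) = Exi (expand d \<phi>)"

definition to_B :: "betweenness fm \<Rightarrow> strict fm" where
  "to_B = expand (\<lambda>r a b c. case r of
     Strict \<Rightarrow> Betw StrictOnly a b c
   | Nonstrict \<Rightarrow> \<^bold>\<not> (a \<^bold>\<noteq> b \<^bold>\<and> b \<^bold>\<noteq> c \<^bold>\<and> \<^bold>\<not> Betw StrictOnly a b c))"

definition to_T :: "betweenness fm \<Rightarrow> nonstrict fm" where
  "to_T = expand (\<lambda>r a b c. case r of
     Strict \<Rightarrow> Betw NonstrictOnly a b c \<^bold>\<and> a \<^bold>\<noteq> b \<^bold>\<and> b \<^bold>\<noteq> c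
   | Nonstrict \<Rightarrow> Betw NonstrictOnly a b c)"

abbreviation Col :: "nat \<Rightarrow> nat \<Rightarrow> nat \<Rightarrow> betweenness fm" where
  "Col a b c \<equiv> \<^bold>\<not> (\<^bold>\<not> T c a b \<^bold>\<and> \<^bold>\<not> T a c b \<^bold>\<and> \<^bold>\<not> T a b c)"


section \<open>The axioms\<close>

text \<open>
  The axioms are written with named variables; \<open>bind x \<phi>\<close> turns the free variable \<open>x\<close>
  into the index bound by a quantifier put in front, shifting all other free variables.
\<close>

definition bind :: "nat \<Rightarrow> 'b fm \<Rightarrow> 'b fm" where
  "bind x \<phi> = ren (\<lambda>y. if y = x then 0 else Suc y) \<phi>"

definition all_vars :: "nat list \<Rightarrow> 'b fm \<Rightarrow> 'b fm"  (\<open>\<^bold>\<forall>_\<^bold>. _\<close> [0, 10] 10) where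
  "all_vars xs \<phi> = foldr (\<lambda>x \<psi>. Uni (bind x \<psi>)) xs \<phi>"

definition ex_vars :: "nat list \<Rightarrow> 'b fm \<Rightarrow> 'b fm"  (\<open>\<^bold>\<exists>_\<^bold>. _\<close> [0, 10] 10) where
  "ex_vars xs \<phi> = foldr (\<lambda>x \<psi>. Exi (bind x \<psi>)) xs \<phi>"

abbreviation (input) "va \<equiv> 0 :: nat"
abbreviation (input) "vb \<equiv> 1 :: nat"
abbreviation (input) "vc \<equiv> 2 :: nat"
abbreviation (input) "vd \<equiv> 3 :: nat"
abbreviation (input) "vp \<equiv> 4 :: nat"
abbreviation (input) "vq \<equiv> 5 :: nat"
abbreviation (input) "vr \<equiv> 6 :: nat"
abbreviation (input) "vs \<equiv> 7 :: nat"
abbreviation (input) "vu \<equiv> 8 :: nat"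
abbreviation (input) "vv \<equiv> 9 :: nat"
abbreviation (input) "vx \<equiv> 10 :: nat"
abbreviation (input) "vy \<equiv> 11 :: nat"
abbreviation (input) "vz \<equiv> 12 :: nat"
abbreviation (input) "vA \<equiv> 13 :: nat"
abbreviation (input) "vB \<equiv> 14 :: nat"
abbreviation (input) "vC \<equiv> 15 :: nat"
abbreviation (input) "vD \<equiv> 16 :: nat"

definition A1 :: "betweenness fm" where
  "A1 = (\<^bold>\<forall>[va, vb]\<^bold>. Cong va vb vb va)"

definition A2 :: "betweenness fm" where
  "A2 = (\<^bold>\<forall>[va, vb, vp, vq, vr, vs]\<^bold>.
     Cong va vb vp vq \<^bold>\<and> Cong va vb vr vs \<^bold>\<longrightarrow> Cong vp vq vr vs)"

definition A3 :: "betweenness fm" where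
  "A3 = (\<^bold>\<forall>[va, vb, vc]\<^bold>. Cong va vb vc vc \<^bold>\<longrightarrow> va \<^bold>= vb)"

definition A4 :: "betweenness fm" where
  "A4 = (\<^bold>\<forall>[va, vb, vc, vq]\<^bold>. \<^bold>\<exists>[vx]\<^bold>. T vq va vx \<^bold>\<and> Cong va vx vb vc)"

definition A4_i :: "betweenness fm" where
  "A4_i = (\<^bold>\<forall>[va, vb, vc, vq]\<^bold>. vq \<^bold>\<noteq> va \<^bold>\<longrightarrow> (\<^bold>\<exists>[vx]\<^bold>. T vq va vx \<^bold>\<and> Cong va vx vb vc))"

definition A5 :: "betweenness fm" where
  "A5 = (\<^bold>\<forall>[va, vb, vc, vd, vA, vB, vC, vD]\<^bold>.
     va \<^bold>\<noteq> vb \<^bold>\<and> T va vb vc \<^bold>\<and> T vA vB vC \<^bold>\<and> Cong va vb vA vB \<^bold>\<and> Cong vb vc vB vC \<^bold>\<and>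
     Cong va vd vA vD \<^bold>\<and> Cong vb vd vB vD \<^bold>\<longrightarrow> Cong vc vd vC vD)"

definition A6 :: "betweenness fm" where
  "A6 = (\<^bold>\<forall>[va, vb]\<^bold>. T va vb va \<^bold>\<longrightarrow> va \<^bold>= vb)"

definition A6_i :: "betweenness fm" where
  "A6_i = (\<^bold>\<forall>[va, vb]\<^bold>. \<^bold>\<not> B va vb va)"

definition A7 :: "betweenness fm" where
  "A7 = (\<^bold>\<forall>[va, vb, vc, vp, vq]\<^bold>.
     T va vp vc \<^bold>\<and> T vb vq vc \<^bold>\<longrightarrow> (\<^bold>\<exists>[vx]\<^bold>. T vp vx vb \<^bold>\<and> T vq vx va))"

definition A7_i :: "betweenness fm" where
  "A7_i = (\<^bold>\<forall>[va, vb, vc, vp, vq]\<^bold>.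
     B va vp vc \<^bold>\<and> T vb vq vc \<^bold>\<and> \<^bold>\<not> Col va vb vc \<^bold>\<longrightarrow> (\<^bold>\<exists>[vx]\<^bold>. T vp vx vb \<^bold>\<and> T vq vx va))"

definition A8 :: "betweenness fm" where
  "A8 = (\<^bold>\<exists>[va, vb, vc]\<^bold>. \<^bold>\<not> Col va vb vc)"

definition A9 :: "betweenness fm" where
  "A9 = (\<^bold>\<forall>[va, vb, vp, vq, vr]\<^bold>.
     va \<^bold>\<noteq> vb \<^bold>\<and> Cong vp va vp vb \<^bold>\<and> Cong vq va vq vb \<^bold>\<and> Cong vr va vr vb \<^bold>\<longrightarrow> Col vp vq vr)"

definition A10_3 :: "betweenness fm" where
  "A10_3 = (\<^bold>\<forall>[va, vb, vc]\<^bold>.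
     \<^bold>\<not> Col va vb vc \<^bold>\<longrightarrow> (\<^bold>\<exists>[vx]\<^bold>. Cong va vx vb vx \<^bold>\<and> Cong va vx vc vx))"

definition A14_i :: "betweenness fm" where
  "A14_i = (\<^bold>\<forall>[va, vb, vc]\<^bold>. B va vb vc \<^bold>\<longrightarrow> B vc vb va)"

definition A15_i :: "betweenness fm" where
  "A15_i = (\<^bold>\<forall>[va, vb, vc, vd]\<^bold>. B va vb vd \<^bold>\<and> B vb vc vd \<^bold>\<longrightarrow> B va vb vc)"

definition two_point_line_circle :: "betweenness fm" where
  "two_point_line_circle = (\<^bold>\<forall>[va, vb, vp, vu, vv]\<^bold>.
     Col vu vv vp \<^bold>\<and> vu \<^bold>\<noteq> vv \<^bold>\<and> T va vp vb \<^bold>\<longrightarrow>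
     (\<^bold>\<exists>[vy, vz]\<^bold>. Col vu vv vy \<^bold>\<and> Col vu vv vz \<^bold>\<and> Cong va vy va vb \<^bold>\<and> Cong va vz va vb \<^bold>\<and>
        T vy vp vz \<^bold>\<and> (vp \<^bold>\<noteq> vb \<^bold>\<longrightarrow> vy \<^bold>\<noteq> vz)))"

definition segment_circle :: "betweenness fm" where
  "segment_circle = (\<^bold>\<forall>[va, vb, vp, vq, vx, vy]\<^bold>.
     Cong va vx va vp \<^bold>\<and> T va vx vb \<^bold>\<and> T va vb vy \<^bold>\<and> Cong va vy va vq \<^bold>\<longrightarrow>
     (\<^bold>\<exists>[vz]\<^bold>. T vp vz vq \<^bold>\<and> Cong va vz va vb))"

definition stability_B :: "betweenness fm" where
  "stability_B = (\<^bold>\<forall>[va, vb, vc]\<^bold>. \<^bold>\<not> \<^bold>\<not> B va vb vc \<^bold>\<longrightarrow> B va vb vc)"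

definition stability_Cong :: "betweenness fm" where
  "stability_Cong = (\<^bold>\<forall>[va, vb, vc, vd]\<^bold>. \<^bold>\<not> \<^bold>\<not> Cong va vb vc vd \<^bold>\<longrightarrow> Cong va vb vc vd)"

definition stability_Eql :: "betweenness fm" where
  "stability_Eql = (\<^bold>\<forall>[va, vb]\<^bold>. \<^bold>\<not> va \<^bold>\<noteq> vb \<^bold>\<longrightarrow> va \<^bold>= vb)"

definition intuitionistic_tarski :: "strict fm set" where
  "intuitionistic_tarski = to_B `
     {A1, A2, A3, A4_i, A5, A6_i, A7_i, A8, A9, A10_3, A14_i, A15_i,
      two_point_line_circle, stability_B, stability_Cong, stability_Eql}"

definition classical_tarski :: "nonstrict fm set" where
  "classical_tarski = to_T `
     {A1, A2, A3, A4, A5, A6, A7, A8, A9, A10_3, segment_circle}"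

lemmas axiom_defs =
  A1_def A2_def A3_def A4_def A4_i_def A5_def A6_def A6_i_def A7_def A7_i_def A8_def A9_def
  A10_3_def A14_i_def A15_i_def two_point_line_circle_def segment_circle_def
  stability_B_def stability_Cong_def stability_Eql_def

lemma intuitionistic_tarski_closed: "\<phi> \<in> intuitionistic_tarski \<Longrightarrow> ren f \<phi> = \<phi>"
  unfolding intuitionistic_tarski_def axiom_defs
  by (auto simp: to_B_def all_vars_def ex_vars_def bind_def lift_def eval_nat_numeral)

lemma classical_tarski_closed: "\<phi> \<in> classical_tarski \<Longrightarrow> ren f \<phi> = \<phi>"
  unfolding classical_tarski_def axiom_defs
  by (auto simp: to_T_def all_vars_def ex_vars_def bind_def lift_def eval_nat_numeral)

end

theory Submission
  imports Defs "HOL-Library.Countable"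
begin

text \<open>
  Every axiom of intuitionistic Tarski geometry is built from negative formulas by universal
  quantifiers, existential quantifiers and implications with negative premise, so it implies its own
  Goedel-Gentzen translation; since atoms are stable, the translation can leave them alone and
  fixes negative formulas. Hence it suffices that the intuitionistic axioms, used with classical
  logic, prove the classical ones, and by completeness this is a question about models.

  In a model, the degenerate cases of Pasch's axiom follow from symmetry and inner transitivity of
  betweenness. For segment-circle continuity, the line through the inner point \<open>p\<close> and the outer
  point \<open>q\<close> meets the circle in two points on different sides of \<open>p\<close>. If neither lies between \<open>p\<close> and
  \<open>q\<close>, then \<open>q\<close> lies inside a chord. Drawing the circle through \<open>q\<close> then yields three collinear
  points on one circle. This is impossible: reflecting such points in the midpoints of pairs of them
  moves them to a chord together with its midpoint, and the centre and its mirror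
  image in that midpoint would show that the chord is degenerate.
\<close>

section \<open>Derivations\<close>

lemma lift_simps [simp]: "lift f 0 = 0" "lift f (Suc n) = Suc (f n)"
  by (simp_all add: lift_def)

lemma lift_comp: "lift f \<circ> lift g = lift (f \<circ> g)"
  by (auto simp: lift_def fun_eq_iff split: nat.splits)

lemma lift_id: "lift (\<lambda>n. n) = (\<lambda>n. n)"
  by (auto simp: lift_def fun_eq_iff split: nat.splits)

lemma ren_ren: "ren f (ren g \<phi>) = ren (f \<circ> g) \<phi>"
  by (induction \<phi> arbitrary: f g) (simp_all add: lift_comp)

lemma ren_id: "ren (\<lambda>n. n) \<phi> = \<phi>"
  by (induction \<phi>) (simp_all add: lift_id)

lemma ren_inst: "ren f (inst x \<phi>) = inst (f x) (ren (lift f) \<phi>)"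
  unfolding inst_def ren_ren
  by (rule arg_cong[of _ _ "\<lambda>g. ren g \<phi>"]) (auto simp: fun_eq_iff split: nat.splits)

lemma ren_lift_Suc: "ren (lift f) (ren Suc \<phi>) = ren Suc (ren f \<phi>)"
  unfolding ren_ren by (rule arg_cong[of _ _ "\<lambda>g. ren g \<phi>"]) (auto simp: fun_eq_iff)

text \<open>Passing under an eigenvariable shifts the body of a quantifier by
  \<open>lift Suc\<close>; instantiating at that eigenvariable, index 0, undoes the shift.\<close>

lemma inst_0_ren_lift_Suc: "inst 0 (ren (lift Suc) \<phi>) = \<phi>"
proof -
  have "(case_nat 0 (\<lambda>m. m)) \<circ> lift Suc = (\<lambda>n. n)"
    by (auto simp: fun_eq_iff lift_def split: nat.splits)
  then show ?thesis
    unfolding inst_def ren_ren by (simp add: ren_id)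
qed

section \<open>Structural properties of derivations\<close>

lemma derives_mono: "derives L \<Gamma> \<phi> \<Longrightarrow> \<Gamma> \<subseteq> \<Delta> \<Longrightarrow> derives L \<Delta> \<phi>"
proof (induction arbitrary: \<Delta> rule: derives.induct)
  case (DisE \<Gamma> \<phi> \<psi> \<chi>)
  then show ?case by (meson derives.DisE insert_mono)
next
  case (ExiE \<Gamma> \<phi> \<chi>)
  then show ?case by (meson derives.ExiE insert_mono image_mono)
next
  case (UniI \<Gamma> \<phi>)
  then show ?case by (meson derives.UniI image_mono)
next
  case (ImpI \<phi> \<Gamma> \<psi>)
  then show ?case by (meson derives.ImpI insert_mono)
qed (blast intro: derives.intros)+

lemma derives_insert: "derives L \<Gamma> \<phi> \<Longrightarrow> derives L (insert \<psi> \<Gamma>) \<phi>"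
  by (rule derives_mono) auto

lemma derives_mp:
  "derives L \<Gamma> (\<phi> \<^bold>\<longrightarrow> \<psi>) \<Longrightarrow> \<Gamma> \<subseteq> \<Delta> \<Longrightarrow> derives L \<Delta> \<phi> \<Longrightarrow> derives L \<Delta> \<psi>"
  using derives.ImpE derives_mono by blast

lemma derives_ren: "derives L \<Gamma> \<phi> \<Longrightarrow> derives L (ren f ` \<Gamma>) (ren f \<phi>)"
proof (induction arbitrary: f rule: derives.induct)
  case (UniI \<Gamma> \<phi>)
  from UniI.IH[of "lift f"] show ?case
    by (auto intro: derives.UniI simp: image_image ren_lift_Suc)
next
  case (ExiE \<Gamma> \<phi> \<chi>)
  from ExiE.IH(2)[of "lift f"] ExiE.IH(1)[of f] show ?case
    by (auto intro: derives.ExiE simp: image_image ren_lift_Suc)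
next
  case (EqlE \<Gamma> x y \<phi>)
  from EqlE.IH[of f] show ?case
    unfolding ren.simps ren_inst by (rule derives.EqlE)
next
  case (UniE \<Gamma> \<phi> x)
  from UniE.IH[of f] show ?case
    unfolding ren.simps ren_inst by (rule derives.UniE)
next
  case (ExiI \<Gamma> x \<phi>)
  from ExiI.IH[of f] show ?case
    unfolding ren.simps ren_inst by (rule derives.ExiI)
next
  case (DisE \<Gamma> \<phi> \<psi> \<chi>)
  from DisE.IH(1-3)[of f] show ?case by (simp add: derives.DisE)
qed (simp_all, (blast intro: derives.intros)+)

text \<open>Derivations of the hypotheses are grafted onto the leaves that use them; above a
  quantifier rule they are renamed together with the context.\<close>

lemma derives_cut:
  "derives L \<Gamma> \<phi> \<Longrightarrow> (\<And>\<gamma>. \<gamma> \<in> \<Gamma> \<Longrightarrow> derives L \<Delta> \<gamma>) \<Longrightarrow> derives L \<Delta> \<phi>"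
proof (induction arbitrary: \<Delta> rule: derives.induct)
  case (DisE \<Gamma> \<phi> \<psi> \<chi>)
  have "derives L (insert \<phi> \<Delta>) \<chi>" "derives L (insert \<psi> \<Delta>) \<chi>"
    by (rule DisE.IH; auto intro: derives.Hyp derives_insert DisE.prems)+
  with DisE show ?case by (blast intro: derives.DisE)
next
  case (ImpI \<phi> \<Gamma> \<psi>)
  have "derives L (insert \<phi> \<Delta>) \<psi>"
    by (rule ImpI.IH) (auto intro: derives.Hyp derives_insert ImpI.prems)
  then show ?case by (rule derives.ImpI)
next
  case (UniI \<Gamma> \<phi>)
  have "derives L (ren Suc ` \<Delta>) \<phi>"
    by (rule UniI.IH) (auto intro: derives_ren UniI.prems)
  then show ?case by (rule derives.UniI)
next
  case (ExiE \<Gamma> \<phi> \<chi>)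
  have "derives L (insert \<phi> (ren Suc ` \<Delta>)) (ren Suc \<chi>)"
    by (rule ExiE.IH) (auto intro: derives.Hyp derives_insert derives_ren ExiE.prems)
  with ExiE show ?case by (blast intro: derives.ExiE)
qed (blast intro: derives.intros)+

text \<open>Every rule has finitely many premises, and in the quantifier rules a finite set of
  shifted hypotheses is the shift of a finite set.\<close>

lemma derives_compact:
  "derives L \<Gamma> \<phi> \<Longrightarrow> \<exists>\<Delta>. finite \<Delta> \<and> \<Delta> \<subseteq> \<Gamma> \<and> derives L \<Delta> \<phi>"
proof (induction rule: derives.induct)
  case (Hyp \<phi> \<Gamma>)
  then show ?case by (intro exI[of _ "{\<phi>}"]) (auto intro: derives.Hyp)
next
  case (ConI \<Gamma> \<phi> \<psi>)
  then obtain \<Delta> \<Delta>' where "finite \<Delta>" "\<Delta> \<subseteq> \<Gamma>" "derives L \<Delta> \<phi>" "finite \<Delta>'" "\<Delta>' \<subseteq> \<Gamma>" "derives L \<Delta>' \<psi>"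
    by blast
  then show ?case
    by (intro exI[of _ "\<Delta> \<union> \<Delta>'"]) (meson Un_least Un_upper1 Un_upper2 derives.ConI derives_mono finite_UnI)
next
  case (DisE \<Gamma> \<phi> \<psi> \<chi>)
  then obtain \<Delta>1 \<Delta>2 \<Delta>3 where *: "finite \<Delta>1" "\<Delta>1 \<subseteq> \<Gamma>" "derives L \<Delta>1 (\<phi> \<^bold>\<or> \<psi>)"
    "finite \<Delta>2" "\<Delta>2 \<subseteq> insert \<phi> \<Gamma>" "derives L \<Delta>2 \<chi>" "finite \<Delta>3" "\<Delta>3 \<subseteq> insert \<psi> \<Gamma>" "derives L \<Delta>3 \<chi>"
    by blast
  let ?\<Delta> = "\<Delta>1 \<union> (\<Delta>2 - {\<phi>}) \<union> (\<Delta>3 - {\<psi>})"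
  have "derives L ?\<Delta> (\<phi> \<^bold>\<or> \<psi>)" "derives L (insert \<phi> ?\<Delta>) \<chi>" "derives L (insert \<psi> ?\<Delta>) \<chi>"
    by (rule derives_mono[OF *(3)] derives_mono[OF *(6)] derives_mono[OF *(9)]; blast)+
  then have "derives L ?\<Delta> \<chi>" by (rule derives.DisE)
  with * show ?case by (intro exI[of _ ?\<Delta>]) auto
next
  case (ImpI \<phi> \<Gamma> \<psi>)
  then obtain \<Delta> where "finite \<Delta>" "\<Delta> \<subseteq> insert \<phi> \<Gamma>" "derives L \<Delta> \<psi>" by blast
  moreover from this have "derives L (insert \<phi> (\<Delta> - {\<phi>})) \<psi>"
    by (elim derives_mono) blast
  ultimately show ?case
    by (intro exI[of _ "\<Delta> - {\<phi>}"]) (auto intro: derives.ImpI)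
next
  case (ImpE \<Gamma> \<phi> \<psi>)
  then obtain \<Delta> \<Delta>' where "finite \<Delta>" "\<Delta> \<subseteq> \<Gamma>" "derives L \<Delta> (\<phi> \<^bold>\<longrightarrow> \<psi>)" "finite \<Delta>'" "\<Delta>' \<subseteq> \<Gamma>" "derives L \<Delta>' \<phi>"
    by blast
  then show ?case
    by (intro exI[of _ "\<Delta> \<union> \<Delta>'"]) (meson Un_least Un_upper1 Un_upper2 derives.ImpE derives_mono finite_UnI)
next
  case (UniI \<Gamma> \<phi>)
  then obtain \<Delta> where "finite \<Delta>" "\<Delta> \<subseteq> ren Suc ` \<Gamma>" "derives L \<Delta> \<phi>" by blast
  then show ?case by (metis derives.UniI finite_subset_image)
next
  case (ExiE \<Gamma> \<phi> \<chi>)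
  then obtain \<Delta> \<Delta>' where *: "finite \<Delta>" "\<Delta> \<subseteq> \<Gamma>" "derives L \<Delta> (Exi \<phi>)"
    "finite \<Delta>'" "\<Delta>' \<subseteq> insert \<phi> (ren Suc ` \<Gamma>)" "derives L \<Delta>' (ren Suc \<chi>)" by blast
  from * have "finite (\<Delta>' - {\<phi>})" "\<Delta>' - {\<phi>} \<subseteq> ren Suc ` \<Gamma>" by auto
  then obtain \<Theta> where \<Theta>: "\<Theta> \<subseteq> \<Gamma>" "finite \<Theta>" "\<Delta>' - {\<phi>} = ren Suc ` \<Theta>"
    by (meson finite_subset_image)
  have "derives L (insert \<phi> (ren Suc ` (\<Delta> \<union> \<Theta>))) (ren Suc \<chi>)"
    using *(6) by (rule derives_mono) (use \<Theta> in auto)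
  moreover have "derives L (\<Delta> \<union> \<Theta>) (Exi \<phi>)" using *(3) by (rule derives_mono) auto
  ultimately have "derives L (\<Delta> \<union> \<Theta>) \<chi>" by (rule derives.ExiE[rotated])
  with * \<Theta> show ?case by (intro exI[of _ "\<Delta> \<union> \<Theta>"]) auto
next
  case (EqlI \<Gamma> x)
  show ?case by (intro exI[of _ "{}"]) (auto intro: derives.EqlI)
next
  case (EqlE \<Gamma> x y \<phi>)
  then obtain \<Delta> \<Delta>' where "finite \<Delta>" "\<Delta> \<subseteq> \<Gamma>" "derives L \<Delta> (x \<^bold>= y)" "finite \<Delta>'" "\<Delta>' \<subseteq> \<Gamma>" "derives L \<Delta>' (inst x \<phi>)"
    by blast
  then show ?case
    by (intro exI[of _ "\<Delta> \<union> \<Delta>'"]) (meson Un_least Un_upper1 Un_upper2 derives.EqlE derives_mono finite_UnI)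
next
  case (UniE \<Gamma> \<phi> x)
  then show ?case by (blast intro: derives.UniE)
next
  case (ExiI \<Gamma> x \<phi>)
  then show ?case by (blast intro: derives.ExiI)
qed (blast intro: derives.FalsumE derives.ConE1 derives.ConE2 derives.DisI1 derives.DisI2 derives.DNE)+

lemma derives_Hyp0: "derives L (insert \<phi> \<Gamma>) \<phi>"
  by (rule derives.Hyp) simp

lemma derives_Uni_Suc: "derives L \<Gamma> (Uni (ren (lift Suc) \<phi>)) \<Longrightarrow> derives L \<Gamma> \<phi>"
  using derives.UniE[of L \<Gamma> "ren (lift Suc) \<phi>" 0] by (simp add: inst_0_ren_lift_Suc)

text \<open>Opens a double negation for the sake of a doubly negated goal, in either logic;
  \<open>gg_stable\<close> uses this to push double negations inward.\<close>

lemma double_neg_bind: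
  assumes "derives L \<Gamma> (\<^bold>\<not> \<^bold>\<not> \<phi>)" "derives L (insert \<phi> \<Gamma>) \<psi>"
  shows "derives L \<Gamma> (\<^bold>\<not> \<^bold>\<not> \<psi>)"
proof (rule derives.ImpI, rule derives.ImpE)
  show "derives L (insert (\<^bold>\<not> \<psi>) \<Gamma>) (\<^bold>\<not> \<^bold>\<not> \<phi>)"
    using assms(1) by (rule derives_insert)
  show "derives L (insert (\<^bold>\<not> \<psi>) \<Gamma>) (\<^bold>\<not> \<phi>)"
  proof (rule derives.ImpI, rule derives.ImpE)
    show "derives L (insert \<phi> (insert (\<^bold>\<not> \<psi>) \<Gamma>)) (\<^bold>\<not> \<psi>)"
      by (rule derives.Hyp) simp
    show "derives L (insert \<phi> (insert (\<^bold>\<not> \<psi>) \<Gamma>)) \<psi>"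
      using assms(2) by (rule derives_mono) auto
  qed
qed

lemma triple_neg:
  assumes "derives L \<Gamma> (\<^bold>\<not> \<^bold>\<not> \<^bold>\<not> \<phi>)"
  shows "derives L \<Gamma> (\<^bold>\<not> \<phi>)"
proof (rule derives.ImpI, rule derives.ImpE)
  show "derives L (insert \<phi> \<Gamma>) (\<^bold>\<not> \<^bold>\<not> \<^bold>\<not> \<phi>)"
    using assms by (rule derives_insert)
  show "derives L (insert \<phi> \<Gamma>) (\<^bold>\<not> \<^bold>\<not> \<phi>)"
    by (rule derives.ImpI, rule derives.ImpE[of _ _ \<phi>]; rule derives.Hyp) simp_all
qed

section \<open>The Goedel-Gentzen translation\<close>

text \<open>Atoms are not doubly negated, since they are stable in the theories considered.\<close>

primrec gg :: "'b fm \<Rightarrow> 'b fm" where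
  "gg \<^bold>\<bottom> = \<^bold>\<bottom>"
| "gg (x \<^bold>= y) = (x \<^bold>= y)"
| "gg (Betw r x y z) = Betw r x y z"
| "gg (Cong x y z w) = Cong x y z w"
| "gg (\<phi> \<^bold>\<and> \<psi>) = (gg \<phi> \<^bold>\<and> gg \<psi>)"
| "gg (\<phi> \<^bold>\<or> \<psi>) = (\<^bold>\<not> (\<^bold>\<not> gg \<phi> \<^bold>\<and> \<^bold>\<not> gg \<psi>))"
| "gg (\<phi> \<^bold>\<longrightarrow> \<psi>) = (gg \<phi> \<^bold>\<longrightarrow> gg \<psi>)"
| "gg (Uni \<phi>) = Uni (gg \<phi>)"
| "gg (Exi \<phi>) = (\<^bold>\<not> Uni (\<^bold>\<not> gg \<phi>))"

lemma gg_ren: "gg (ren f \<phi>) = ren f (gg \<phi>)"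
  by (induction \<phi> arbitrary: f) simp_all

lemma gg_inst: "gg (inst x \<phi>) = inst x (gg \<phi>)"
  by (simp add: inst_def gg_ren)

lemma inst_Imp_Falsum: "inst x (\<^bold>\<not> \<phi>) = (\<^bold>\<not> inst x \<phi>)"
  by (simp add: inst_def)

lemma gg_negative: "negative \<phi> \<Longrightarrow> gg \<phi> = \<phi>"
  by (induction \<phi>) simp_all

text \<open>To pass from an implication to its translation, the premise must follow from the
  translated premise. Negative premises are fixed by the translation, which settles this.\<close>

primrec gg_provable_form :: "'b fm \<Rightarrow> bool" where
  "gg_provable_form \<^bold>\<bottom> \<longleftrightarrow> True"
| "gg_provable_form (x \<^bold>= y) \<longleftrightarrow> True"
| "gg_provable_form (Betw r x y z) \<longleftrightarrow> True"
| "gg_provable_form (Cong x y z w) \<longleftrightarrow> True"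
| "gg_provable_form (\<phi> \<^bold>\<and> \<psi>) \<longleftrightarrow> gg_provable_form \<phi> \<and> gg_provable_form \<psi>"
| "gg_provable_form (\<phi> \<^bold>\<or> \<psi>) \<longleftrightarrow> False"
| "gg_provable_form (\<phi> \<^bold>\<longrightarrow> \<psi>) \<longleftrightarrow> negative \<phi> \<and> gg_provable_form \<psi>"
| "gg_provable_form (Uni \<phi>) \<longleftrightarrow> gg_provable_form \<phi>"
| "gg_provable_form (Exi \<phi>) \<longleftrightarrow> gg_provable_form \<phi>"

text \<open>The critical case is the existential: its translation is proved by letting a witness
  refute the assumed universal negation.\<close>

lemma derives_gg_of_derives:
  "gg_provable_form \<phi> \<Longrightarrow> derives L \<Gamma> \<phi> \<Longrightarrow> derives L \<Gamma> (gg \<phi>)"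
proof (induction \<phi> arbitrary: \<Gamma>)
  case (Con \<phi> \<psi>)
  then show ?case by (auto intro: derives.ConI dest: derives.ConE1 derives.ConE2)
next
  case (Imp \<phi> \<psi>)
  have "derives L (insert \<phi> \<Gamma>) \<psi>"
    using derives_insert[OF Imp.prems(2)] derives_Hyp0 by (rule derives.ImpE)
  with Imp have "derives L (insert \<phi> \<Gamma>) (gg \<psi>)" by simp
  with Imp.prems(1) show ?case by (auto intro: derives.ImpI simp: gg_negative)
next
  case (Uni \<phi>)
  have "derives L (ren Suc ` \<Gamma>) \<phi>"
    using derives_ren[OF Uni.prems(2), of Suc] by (auto intro: derives_Uni_Suc)
  with Uni show ?case by (auto intro: derives.UniI)
next
  case (Exi \<phi>)
  let ?\<Delta> = "insert (Uni (\<^bold>\<not> gg \<phi>)) \<Gamma>"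
  have "derives L (insert \<phi> (ren Suc ` ?\<Delta>)) (\<^bold>\<not> gg \<phi>)"
    by (rule derives_Uni_Suc, rule derives.Hyp) simp
  moreover have "derives L (insert \<phi> (ren Suc ` ?\<Delta>)) (gg \<phi>)"
    using Exi.prems(1) by (intro Exi.IH) (simp_all add: derives_Hyp0)
  ultimately have "derives L (insert \<phi> (ren Suc ` ?\<Delta>)) (ren Suc \<^bold>\<bottom>)"
    by (auto intro: derives.ImpE)
  then have "derives L ?\<Delta> \<^bold>\<bottom>"
    using derives_insert[OF Exi.prems(2)] by (blast intro: derives.ExiE)
  then show ?case by (auto intro: derives.ImpI)
qed simp_all

text \<open>Closedness makes \<open>S\<close> invariant under the shifts of the quantifier rules;
  stability is what allows \<open>gg\<close> to leave atoms alone.\<close>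

definition stable_atoms :: "'b fm set \<Rightarrow> bool" where
  "stable_atoms S \<longleftrightarrow> (\<forall>\<phi>\<in>S. \<forall>f. ren f \<phi> = \<phi>) \<and>
     (\<forall>x y. derives Intuitionistic S (\<^bold>\<not> \<^bold>\<not> (x \<^bold>= y) \<^bold>\<longrightarrow> x \<^bold>= y)) \<and>
     (\<forall>r x y z. derives Intuitionistic S (\<^bold>\<not> \<^bold>\<not> Betw r x y z \<^bold>\<longrightarrow> Betw r x y z)) \<and>
     (\<forall>x y z w. derives Intuitionistic S (\<^bold>\<not> \<^bold>\<not> Cong x y z w \<^bold>\<longrightarrow> Cong x y z w))"

lemma stable_atoms_ren_image: "stable_atoms S \<Longrightarrow> ren f ` S = S"
  unfolding stable_atoms_def by force

text \<open>A double negation moves inward through conjunction, implication and universal quantifier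
  down to the atoms, where \<open>S\<close> removes it. Translated disjunctions and existentials are
  negations, for which a triple negation collapses.\<close>

lemma gg_stable:
  assumes "stable_atoms S"
  shows "S \<subseteq> \<Gamma> \<Longrightarrow> derives Intuitionistic \<Gamma> (\<^bold>\<not> \<^bold>\<not> gg \<phi>) \<Longrightarrow> derives Intuitionistic \<Gamma> (gg \<phi>)"
proof (induction \<phi> arbitrary: \<Gamma>)
  case Falsum
  have "derives Intuitionistic \<Gamma> (\<^bold>\<not> \<^bold>\<bottom>)"
    by (rule derives.ImpI) (rule derives_Hyp0)
  with Falsum.prems(2) show ?case
    unfolding gg.simps by (rule derives.ImpE)
next
  case (Con \<phi> \<psi>)
  have "derives Intuitionistic \<Gamma> (\<^bold>\<not> \<^bold>\<not> gg \<phi>)" "derives Intuitionistic \<Gamma> (\<^bold>\<not> \<^bold>\<not> gg \<psi>)"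
    using double_neg_bind[OF Con.prems(2)[simplified]] derives.ConE1[OF derives_Hyp0]
      derives.ConE2[OF derives_Hyp0] by blast+
  with Con show ?case by (simp add: derives.ConI)
next
  case (Imp \<phi> \<psi>)
  have "derives Intuitionistic (insert (gg \<phi>) \<Gamma>) (\<^bold>\<not> \<^bold>\<not> (gg \<phi> \<^bold>\<longrightarrow> gg \<psi>))"
    using Imp.prems(2) by (simp add: derives_insert)
  then have "derives Intuitionistic (insert (gg \<phi>) \<Gamma>) (\<^bold>\<not> \<^bold>\<not> gg \<psi>)"
    by (rule double_neg_bind) (rule derives.ImpE[of _ _ "gg \<phi>"]; rule derives.Hyp; simp)
  then have "derives Intuitionistic (insert (gg \<phi>) \<Gamma>) (gg \<psi>)"
    using Imp.IH(2)[of "insert (gg \<phi>) \<Gamma>"] Imp.prems(1) by blast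
  then show ?case by (simp add: derives.ImpI)
next
  case (Uni \<phi>)
  have "derives Intuitionistic (ren Suc ` \<Gamma>) (\<^bold>\<not> \<^bold>\<not> Uni (ren (lift Suc) (gg \<phi>)))"
    using derives_ren[OF Uni.prems(2), of Suc] by simp
  then have "derives Intuitionistic (ren Suc ` \<Gamma>) (\<^bold>\<not> \<^bold>\<not> gg \<phi>)"
    by (rule double_neg_bind) (rule derives_Uni_Suc, rule derives_Hyp0)
  moreover have "S \<subseteq> ren Suc ` \<Gamma>"
    using Uni.prems(1) stable_atoms_ren_image[OF assms, of Suc] by blast
  ultimately show ?case by (simp add: derives.UniI Uni.IH)
next
  case (Eql x y)
  have "derives Intuitionistic S (\<^bold>\<not> \<^bold>\<not> (x \<^bold>= y) \<^bold>\<longrightarrow> x \<^bold>= y)"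
    using assms by (simp add: stable_atoms_def)
  from derives_mp[OF this Eql.prems(1)] Eql.prems(2) show ?case by simp
next
  case (Betw r x y z)
  have "derives Intuitionistic S (\<^bold>\<not> \<^bold>\<not> (Betw r x y z) \<^bold>\<longrightarrow> Betw r x y z)"
    using assms by (simp add: stable_atoms_def)
  from derives_mp[OF this Betw.prems(1)] Betw.prems(2) show ?case by simp
next
  case (Cong x y z w)
  have "derives Intuitionistic S (\<^bold>\<not> \<^bold>\<not> (Cong x y z w) \<^bold>\<longrightarrow> Cong x y z w)"
    using assms by (simp add: stable_atoms_def)
  from derives_mp[OF this Cong.prems(1)] Cong.prems(2) show ?case by simp
next
  case (Dis \<phi> \<psi>)
  from triple_neg[OF Dis.prems(2)[unfolded gg.simps]] show ?case by simp
next
  case (Exi \<phi>)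
  from triple_neg[OF Exi.prems(2)[unfolded gg.simps]] show ?case by simp
qed

text \<open>Eliminating a translated disjunction or existential only refutes the negated goal; the
  goal is a translation, so \<open>gg_stable\<close> recovers it. The same lemma handles double
  negation elimination.\<close>

theorem derives_gg:
  assumes S: "stable_atoms S"
  shows "derives L \<Gamma> \<phi> \<Longrightarrow> derives Intuitionistic (gg ` \<Gamma> \<union> S) (gg \<phi>)"
proof (induction rule: derives.induct)
  case (DisE \<Gamma> \<phi> \<psi> \<chi>)
  let ?\<Gamma> = "gg ` \<Gamma> \<union> S"
  \<comment> \<open>A branch that proves the goal refutes its own case once the negated goal is
    assumed.\<close>
  have neg: "derives Intuitionistic (insert (\<^bold>\<not> gg \<chi>) ?\<Gamma>) (\<^bold>\<not> \<theta>)"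
    if "derives Intuitionistic (insert \<theta> ?\<Gamma>) (gg \<chi>)" for \<theta>
  proof (rule derives.ImpI, rule derives.ImpE)
    show "derives Intuitionistic (insert \<theta> (insert (\<^bold>\<not> gg \<chi>) ?\<Gamma>)) (\<^bold>\<not> gg \<chi>)"
      by (rule derives.Hyp) simp
    show "derives Intuitionistic (insert \<theta> (insert (\<^bold>\<not> gg \<chi>) ?\<Gamma>)) (gg \<chi>)"
      using that by (rule derives_mono) auto
  qed
  have "derives Intuitionistic (insert (\<^bold>\<not> gg \<chi>) ?\<Gamma>) (\<^bold>\<not> (\<^bold>\<not> gg \<phi> \<^bold>\<and> \<^bold>\<not> gg \<psi>))"
    using DisE.IH(1) by (simp add: derives_insert)
  then have "derives Intuitionistic (insert (\<^bold>\<not> gg \<chi>) ?\<Gamma>) \<^bold>\<bottom>"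
    by (rule derives.ImpE) (use DisE.IH(2,3) in \<open>auto intro!: derives.ConI neg\<close>)
  then show ?case using gg_stable[OF S, of ?\<Gamma> \<chi>] by (auto intro: derives.ImpI)
next
  case (UniI \<Gamma> \<phi>)
  have "gg ` ren Suc ` \<Gamma> \<union> S = ren Suc ` (gg ` \<Gamma> \<union> S)"
    using stable_atoms_ren_image[OF S] by (auto simp: image_Un image_image gg_ren)
  with UniI.IH show ?case by (auto intro: derives.UniI)
next
  case (ExiE \<Gamma> \<phi> \<chi>)
  let ?\<Gamma> = "gg ` \<Gamma> \<union> S"
  let ?\<Delta> = "insert (\<^bold>\<not> gg \<chi>) ?\<Gamma>"
  have eq: "gg ` insert \<phi> (ren Suc ` \<Gamma>) \<union> S = insert (gg \<phi>) (ren Suc ` ?\<Gamma>)"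
    using stable_atoms_ren_image[OF S] by (auto simp: image_Un image_image gg_ren)
  have "derives Intuitionistic (insert (gg \<phi>) (ren Suc ` ?\<Delta>)) (ren Suc (gg \<chi>))"
    using ExiE.IH(2) unfolding eq gg_ren by (rule derives_mono) auto
  moreover have "derives Intuitionistic (insert (gg \<phi>) (ren Suc ` ?\<Delta>)) (\<^bold>\<not> ren Suc (gg \<chi>))"
    by (rule derives.Hyp) simp
  ultimately have "derives Intuitionistic (ren Suc ` ?\<Delta>) (\<^bold>\<not> gg \<phi>)"
    by (blast intro: derives.ImpI derives.ImpE)
  then have "derives Intuitionistic ?\<Delta> (Uni (\<^bold>\<not> gg \<phi>))"
    by (rule derives.UniI)
  moreover have "derives Intuitionistic ?\<Delta> (\<^bold>\<not> Uni (\<^bold>\<not> gg \<phi>))"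
    using ExiE.IH(1) by (simp add: derives_insert)
  ultimately have "derives Intuitionistic ?\<Delta> \<^bold>\<bottom>"
    by (blast intro: derives.ImpE)
  then show ?case using gg_stable[OF S, of ?\<Gamma> \<chi>] by (auto intro: derives.ImpI)
next
  case (ExiI \<Gamma> x \<phi>)
  let ?\<Delta> = "insert (Uni (\<^bold>\<not> gg \<phi>)) (gg ` \<Gamma> \<union> S)"
  have "derives Intuitionistic ?\<Delta> (\<^bold>\<not> inst x (gg \<phi>))"
    using derives.UniE[OF derives_Hyp0] by (metis inst_Imp_Falsum)
  moreover have "derives Intuitionistic ?\<Delta> (inst x (gg \<phi>))"
    using ExiI.IH by (auto intro: derives_insert simp: gg_inst)
  ultimately show ?case by (auto intro: derives.ImpI derives.ImpE)
next
  case (DNE \<Gamma> \<phi>)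
  then show ?case using gg_stable[OF S] by simp
next
  case (DisI1 \<Gamma> \<phi> \<psi>)
  let ?\<Delta> = "insert (\<^bold>\<not> gg \<phi> \<^bold>\<and> \<^bold>\<not> gg \<psi>) (gg ` \<Gamma> \<union> S)"
  have "derives Intuitionistic ?\<Delta> (\<^bold>\<not> gg \<phi>)" "derives Intuitionistic ?\<Delta> (gg \<phi>)"
    using DisI1.IH derives.ConE1[OF derives_Hyp0] by (auto intro: derives_insert)
  then show ?case by (auto intro: derives.ImpI derives.ImpE)
next
  case (DisI2 \<Gamma> \<psi> \<phi>)
  let ?\<Delta> = "insert (\<^bold>\<not> gg \<phi> \<^bold>\<and> \<^bold>\<not> gg \<psi>) (gg ` \<Gamma> \<union> S)"
  have "derives Intuitionistic ?\<Delta> (\<^bold>\<not> gg \<psi>)" "derives Intuitionistic ?\<Delta> (gg \<psi>)"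
    using DisI2.IH derives.ConE2[OF derives_Hyp0] by (auto intro: derives_insert)
  then show ?case by (auto intro: derives.ImpI derives.ImpE)
next
  case (UniE \<Gamma> \<phi> x)
  from UniE.IH show ?case unfolding gg.simps gg_inst by (rule derives.UniE)
next
  case (EqlE \<Gamma> x y \<phi>)
  from EqlE.IH show ?case unfolding gg.simps gg_inst by (rule derives.EqlE)
qed (simp_all, (blast intro: derives.intros)+)

section \<open>Semantics and completeness\<close>

text \<open>Equality is read as identity of points, so the term model has to be a quotient of the
  variables.\<close>

primrec sat :: "('b \<Rightarrow> 'a \<Rightarrow> 'a \<Rightarrow> 'a \<Rightarrow> bool) \<Rightarrow> ('a \<Rightarrow> 'a \<Rightarrow> 'a \<Rightarrow> 'a \<Rightarrow> bool) \<Rightarrow> (nat \<Rightarrow> 'a) \<Rightarrow> 'b fm \<Rightarrow> bool"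
where
  "sat I C e \<^bold>\<bottom> \<longleftrightarrow> False"
| "sat I C e (x \<^bold>= y) \<longleftrightarrow> e x = e y"
| "sat I C e (Betw r x y z) \<longleftrightarrow> I r (e x) (e y) (e z)"
| "sat I C e (Cong x y z w) \<longleftrightarrow> C (e x) (e y) (e z) (e w)"
| "sat I C e (\<phi> \<^bold>\<and> \<psi>) \<longleftrightarrow> sat I C e \<phi> \<and> sat I C e \<psi>"
| "sat I C e (\<phi> \<^bold>\<or> \<psi>) \<longleftrightarrow> sat I C e \<phi> \<or> sat I C e \<psi>"
| "sat I C e (\<phi> \<^bold>\<longrightarrow> \<psi>) \<longleftrightarrow> (sat I C e \<phi> \<longrightarrow> sat I C e \<psi>)"
| "sat I C e (Uni \<phi>) \<longleftrightarrow> (\<forall>d. sat I C (case_nat d e) \<phi>)"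
| "sat I C e (Exi \<phi>) \<longleftrightarrow> (\<exists>d. sat I C (case_nat d e) \<phi>)"

lemma case_nat_lift: "case_nat d e \<circ> lift f = case_nat d (e \<circ> f)"
  by (auto simp: fun_eq_iff split: nat.splits)

lemma case_nat_comp: "case_nat (g x) (g \<circ> f) = g \<circ> case_nat x f"
  by (auto simp: fun_eq_iff split: nat.splits)

lemma inst_ren_lift: "inst x (ren (lift f) \<phi>) = ren (case_nat x f) \<phi>"
  unfolding inst_def ren_ren
  by (rule arg_cong[of _ _ "\<lambda>g. ren g \<phi>"]) (auto simp: fun_eq_iff split: nat.splits)

lemma sat_ren: "sat I C e (ren f \<phi>) \<longleftrightarrow> sat I C (e \<circ> f) \<phi>"
  by (induction \<phi> arbitrary: e f) (simp_all add: case_nat_lift)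

lemma sat_ren_Suc [simp]: "sat I C (case_nat d e) (ren Suc \<phi>) \<longleftrightarrow> sat I C e \<phi>"
  by (simp add: sat_ren comp_def)

lemma sat_inst: "sat I C e (inst x \<phi>) \<longleftrightarrow> sat I C (case_nat (e x) e) \<phi>"
proof -
  have "e \<circ> case_nat x (\<lambda>m. m) = case_nat (e x) e"
    by (auto simp: fun_eq_iff split: nat.splits)
  then show ?thesis by (simp add: inst_def sat_ren)
qed

text \<open>The metalogic is classical, so one induction covers both values of
  \<open>L\<close>.\<close>

theorem soundness:
  "derives L \<Gamma> \<phi> \<Longrightarrow> (\<And>\<gamma>. \<gamma> \<in> \<Gamma> \<Longrightarrow> sat I C e \<gamma>) \<Longrightarrow> sat I C e \<phi>"
proof (induction arbitrary: e rule: derives.induct)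
  case (UniI \<Gamma> \<phi>)
  have "sat I C (case_nat d e) \<phi>" for d
    by (rule UniI.IH) (auto simp: UniI.prems)
  then show ?case by simp
next
  case (ExiE \<Gamma> \<phi> \<chi>)
  from ExiE.IH(1)[OF ExiE.prems] obtain d where "sat I C (case_nat d e) \<phi>" by auto
  then have "sat I C (case_nat d e) (ren Suc \<chi>)"
    by (intro ExiE.IH(2)) (auto simp: ExiE.prems)
  then show ?case by simp
next
  case (DisE \<Gamma> \<phi> \<psi> \<chi>)
  from DisE.IH(1)[OF DisE.prems] show ?case
    using DisE.IH(2,3)[of e] DisE.prems by auto
next
  case (ImpI \<phi> \<Gamma> \<psi>)
  then show ?case by auto
next
  case (EqlE \<Gamma> x y \<phi>)
  from EqlE.IH[OF EqlE.prems] show ?case by (simp add: sat_inst)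
next
  case (UniE \<Gamma> \<phi> x)
  from UniE.IH[OF UniE.prems] show ?case by (simp add: sat_inst)
next
  case (ExiI \<Gamma> x \<phi>)
  from ExiI.IH[OF ExiI.prems] show ?case by (auto simp: sat_inst)
next
  case (FalsumE \<Gamma> \<phi>)
  from FalsumE.IH[OF FalsumE.prems] show ?case by simp
qed simp_all

section \<open>Free variables\<close>

primrec fv :: "'b fm \<Rightarrow> nat set" where
  "fv \<^bold>\<bottom> = {}"
| "fv (x \<^bold>= y) = {x, y}"
| "fv (Betw r x y z) = {x, y, z}"
| "fv (Cong x y z w) = {x, y, z, w}"
| "fv (\<phi> \<^bold>\<and> \<psi>) = fv \<phi> \<union> fv \<psi>"
| "fv (\<phi> \<^bold>\<or> \<psi>) = fv \<phi> \<union> fv \<psi>"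
| "fv (\<phi> \<^bold>\<longrightarrow> \<psi>) = fv \<phi> \<union> fv \<psi>"
| "fv (Uni \<phi>) = Suc -` fv \<phi>"
| "fv (Exi \<phi>) = Suc -` fv \<phi>"

lemma finite_fv [simp]: "finite (fv \<phi>)"
  by (induction \<phi>) (simp_all add: finite_vimageI)

lemma ren_cong: "(\<And>x. x \<in> fv \<phi> \<Longrightarrow> f x = g x) \<Longrightarrow> ren f \<phi> = ren g \<phi>"
proof (induction \<phi> arbitrary: f g)
  case (Uni \<phi>)
  have "lift f x = lift g x" if "x \<in> fv \<phi>" for x
    using that Uni.prems by (cases x) simp_all
  from Uni.IH[OF this] show ?case by simp
next
  case (Exi \<phi>)
  have "lift f x = lift g x" if "x \<in> fv \<phi>" for x
    using that Exi.prems by (cases x) simp_all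
  from Exi.IH[OF this] show ?case by simp
next
  case (Con \<phi> \<psi>)
  from Con.IH[of f g] Con.prems show ?case by simp
next
  case (Dis \<phi> \<psi>)
  from Dis.IH[of f g] Dis.prems show ?case by simp
next
  case (Imp \<phi> \<psi>)
  from Imp.IH[of f g] Imp.prems show ?case by simp
qed simp_all

lemma fv_ren: "fv (ren f \<phi>) = f ` fv \<phi>"
proof -
  have *: "Suc -` lift f ` A = f ` (Suc -` A)" for f A
    by (force simp: lift_def split: nat.splits)
  show ?thesis
    by (induction \<phi> arbitrary: f) (simp_all add: * image_Un)
qed

text \<open>A largest free variable would be shifted to a larger one that is again free.\<close>

lemma fv_closed:
  assumes "ren Suc \<phi> = \<phi>"
  shows "fv \<phi> = {}"
proof (rule ccontr)
  assume "fv \<phi> \<noteq> {}"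
  then have "Max (fv \<phi>) \<in> fv \<phi>" by (intro Max_in) auto
  then have "Suc (Max (fv \<phi>)) \<in> fv (ren Suc \<phi>)"
    unfolding fv_ren by (rule imageI)
  then have "Suc (Max (fv \<phi>)) \<in> fv \<phi>" unfolding assms .
  then have "Suc (Max (fv \<phi>)) \<le> Max (fv \<phi>)" by (intro Max_ge) auto
  then show False by simp
qed

section \<open>Henkin's construction\<close>

definition consistent :: "'b fm set \<Rightarrow> bool" where
  "consistent \<Gamma> \<longleftrightarrow> \<not> derives Classical \<Gamma> \<^bold>\<bottom>"

definition saturated :: "'b fm set \<Rightarrow> bool" where
  "saturated H \<longleftrightarrow> consistent H \<and> (\<forall>\<phi>. consistent (insert \<phi> H) \<longrightarrow> \<phi> \<in> H) \<and>
     (\<forall>\<phi>. Exi \<phi> \<in> H \<longrightarrow> (\<exists>x. inst x \<phi> \<in> H))"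

lemma consistent_mono: "consistent \<Delta> \<Longrightarrow> \<Gamma> \<subseteq> \<Delta> \<Longrightarrow> consistent \<Gamma>"
  unfolding consistent_def using derives_mono by blast

lemma inconsistent_insert_iff: "\<not> consistent (insert \<phi> \<Gamma>) \<longleftrightarrow> derives Classical \<Gamma> (\<^bold>\<not> \<phi>)"
proof -
  have "derives Classical (insert \<phi> \<Gamma>) \<^bold>\<bottom>" if "derives Classical \<Gamma> (\<^bold>\<not> \<phi>)"
    using derives_insert[OF that] derives_Hyp0 by (rule derives.ImpE)
  then show ?thesis unfolding consistent_def by (blast intro: derives.ImpI)
qed

lemma consistent_insert_neg_iff:
  "consistent (insert (\<^bold>\<not> \<phi>) \<Gamma>) \<longleftrightarrow> \<not> derives Classical \<Gamma> \<phi>"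
proof -
  have "derives Classical \<Gamma> (\<^bold>\<not> \<^bold>\<not> \<phi>)" if "derives Classical \<Gamma> \<phi>"
    by (rule derives.ImpI, rule derives.ImpE[OF derives_Hyp0 derives_insert[OF that]])
  then show ?thesis
    using inconsistent_insert_iff derives.DNE[of Classical \<Gamma> \<phi>] by blast
qed

text \<open>A renaming turns the fresh variable into the eigenvariable of existential elimination,
  which then discharges the instance.\<close>

lemma consistent_insert_witness:
  assumes "consistent \<Gamma>" "Exi \<phi> \<in> \<Gamma>" "x \<notin> \<Union> (fv ` \<Gamma>)"
  shows "consistent (insert (inst x \<phi>) \<Gamma>)"
proof (rule ccontr)
  assume "\<not> ?thesis"
  then have der: "derives Classical (insert (inst x \<phi>) \<Gamma>) \<^bold>\<bottom>"
    by (simp add: consistent_def)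
  \<comment> \<open>Sends \<open>x\<close> to the eigenvariable 0 and shifts every other variable:
    on \<open>\<Gamma>\<close>, where \<open>x\<close> is not free, this is \<open>Suc\<close>, and
    on the instance it undoes \<open>inst\<close>.\<close>
  define f where "f = (\<lambda>n. if n = x then 0 else Suc n)"
  have "ren f \<gamma> = ren Suc \<gamma>" if "\<gamma> \<in> \<Gamma>" for \<gamma>
    using that assms(3) by (intro ren_cong) (auto simp: f_def)
  then have \<Gamma>: "ren f ` \<Gamma> = ren Suc ` \<Gamma>" by simp
  have "ren f (inst x \<phi>) = ren (\<lambda>n. n) \<phi>"
    unfolding inst_def ren_ren
  proof (rule ren_cong)
    fix n assume n: "n \<in> fv \<phi>"
    have "m \<noteq> x" if "n = Suc m" for m
      using that n assms(2,3) by (auto simp: image_iff)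
    then show "(f \<circ> case_nat x (\<lambda>m. m)) n = n"
      by (auto simp: f_def split: nat.splits)
  qed
  then have "derives Classical (insert \<phi> (ren Suc ` \<Gamma>)) (ren Suc \<^bold>\<bottom>)"
    using derives_ren[OF der, of f] \<Gamma> by (simp add: ren_id)
  with derives.Hyp[OF assms(2)] have "derives Classical \<Gamma> \<^bold>\<bottom>"
    by (rule derives.ExiE)
  with assms(1) show False by (simp add: consistent_def)
qed

instance fm :: (countable) countable
  by countable_datatype

primrec henkin_step :: "'b fm \<Rightarrow> 'b fm set \<Rightarrow> 'b fm set" where
  "henkin_step \<^bold>\<bottom> \<Gamma> = {}"
| "henkin_step (x \<^bold>= y) \<Gamma> = {}"
| "henkin_step (Betw r x y z) \<Gamma> = {}"
| "henkin_step (Cong x y z w) \<Gamma> = {}"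
| "henkin_step (\<phi> \<^bold>\<and> \<psi>) \<Gamma> = {}"
| "henkin_step (\<phi> \<^bold>\<or> \<psi>) \<Gamma> = {}"
| "henkin_step (\<phi> \<^bold>\<longrightarrow> \<psi>) \<Gamma> = {}"
| "henkin_step (Uni \<phi>) \<Gamma> = {}"
| "henkin_step (Exi \<phi>) \<Gamma> = {inst (SOME x. x \<notin> \<Union> (fv ` \<Gamma>)) \<phi>}"

text \<open>Stage \<open>Suc n\<close> treats the formula with code \<open>n\<close>, so every
  formula gets its turn, and an accepted existential receives its witness at once.\<close>

fun henkin_chain :: "'b :: countable fm set \<Rightarrow> nat \<Rightarrow> 'b fm set" where
  "henkin_chain \<Gamma> 0 = \<Gamma>"
| "henkin_chain \<Gamma> (Suc n) = (let \<Delta> = insert (from_nat n) (henkin_chain \<Gamma> n) in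
     if consistent \<Delta> then \<Delta> \<union> henkin_step (from_nat n) \<Delta> else henkin_chain \<Gamma> n)"

lemma finite_henkin_step: "finite (henkin_step \<phi> \<Delta>)"
  by (cases \<phi>) simp_all

lemma infinite_fresh_finite_Un:
  assumes "infinite (- \<Union> (fv ` \<Gamma>))" "finite \<Delta>"
  shows "infinite (- \<Union> (fv ` (\<Gamma> \<union> \<Delta>)))"
proof -
  have "- \<Union> (fv ` (\<Gamma> \<union> \<Delta>)) = - \<Union> (fv ` \<Gamma>) - \<Union> (fv ` \<Delta>)" by auto
  then show ?thesis using assms by (simp add: Diff_infinite_finite)
qed

lemma consistent_Un_henkin_step:
  assumes "consistent \<Delta>" "\<phi> \<in> \<Delta>" "infinite (- \<Union> (fv ` \<Delta>))"
  shows "consistent (\<Delta> \<union> henkin_step \<phi> \<Delta>)"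
proof (cases \<phi>)
  case (Exi \<psi>)
  obtain x where "x \<notin> \<Union> (fv ` \<Delta>)"
    using infinite_imp_nonempty[OF assms(3)] by auto
  then have "(SOME x. x \<notin> \<Union> (fv ` \<Delta>)) \<notin> \<Union> (fv ` \<Delta>)" by (rule someI)
  then show ?thesis
    using consistent_insert_witness[of \<Delta> \<psi>] assms Exi by simp
qed (use assms(1) in simp_all)

lemma henkin_chain_invariant:
  assumes "consistent \<Gamma>" "infinite (- \<Union> (fv ` \<Gamma>))"
  shows "consistent (henkin_chain \<Gamma> n) \<and> infinite (- \<Union> (fv ` henkin_chain \<Gamma> n))"
proof (induction n)
  case 0
  then show ?case using assms by simp
next
  case (Suc n)
  let ?\<Delta> = "insert (from_nat n) (henkin_chain \<Gamma> n)"
  show ?case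
  proof (cases "consistent ?\<Delta>")
    case True
    have inf: "infinite (- \<Union> (fv ` ?\<Delta>))"
      using infinite_fresh_finite_Un[of "henkin_chain \<Gamma> n" "{from_nat n}"] Suc by simp
    show ?thesis
      using infinite_fresh_finite_Un[OF inf finite_henkin_step, of "from_nat n" ?\<Delta>]
        consistent_Un_henkin_step[OF True _ inf, of "from_nat n"] True
      by (simp add: Let_def)
  next
    case False
    then show ?thesis using Suc by (simp add: Let_def)
  qed
qed

lemma henkin_chain_mono: "m \<le> n \<Longrightarrow> henkin_chain \<Gamma> m \<subseteq> henkin_chain \<Gamma> n"
  by (rule lift_Suc_mono_le[of "henkin_chain \<Gamma>"]) (auto simp: Let_def)

text \<open>The limit of the chain is consistent by compactness, since finitely many of its formulas
  already occur at one stage.\<close>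

theorem saturated_extension:
  fixes \<Gamma> :: "'b :: countable fm set"
  assumes "consistent \<Gamma>" "infinite (- \<Union> (fv ` \<Gamma>))"
  obtains H where "saturated H" "\<Gamma> \<subseteq> H"
proof -
  define H where "H = (\<Union>n. henkin_chain \<Gamma> n)"
  have chain: "henkin_chain \<Gamma> n \<subseteq> H" for n
    unfolding H_def by blast
  \<comment> \<open>Consistency with the limit passes to every stage, so the formula is accepted
    when its own code comes up.\<close>
  have step: "consistent (insert \<phi> (henkin_chain \<Gamma> (to_nat \<phi>)))" if "consistent (insert \<phi> H)" for \<phi>
    using that insert_mono[OF chain] by (rule consistent_mono)
  have cons: "consistent H"
  proof (rule ccontr)
    assume "\<not> consistent H"
    then obtain \<Delta> where \<Delta>: "finite \<Delta>" "\<Delta> \<subseteq> H" "\<not> consistent \<Delta>"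
      unfolding consistent_def using derives_compact[of Classical H "\<^bold>\<bottom>"] by metis
    have "\<exists>n. \<Delta> \<subseteq> henkin_chain \<Gamma> n"
      using \<Delta>(1,2)
    proof (induction rule: finite_induct)
      case (insert \<phi> \<Delta>)
      then obtain n m where "\<Delta> \<subseteq> henkin_chain \<Gamma> n" "\<phi> \<in> henkin_chain \<Gamma> m"
        unfolding H_def by auto
      then have "insert \<phi> \<Delta> \<subseteq> henkin_chain \<Gamma> (max n m)"
        using henkin_chain_mono[of n "max n m" \<Gamma>] henkin_chain_mono[of m "max n m" \<Gamma>] by auto
      then show ?case by blast
    qed simp
    then show False
      using henkin_chain_invariant[OF assms] consistent_mono \<Delta>(3) by blast
  qed
  have max: "\<phi> \<in> H" if "consistent (insert \<phi> H)" for \<phi>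
  proof -
    have "\<phi> \<in> henkin_chain \<Gamma> (Suc (to_nat \<phi>))"
      using step[OF that] by (simp add: Let_def)
    then show ?thesis using chain by blast
  qed
  have "\<exists>x. inst x \<phi> \<in> H" if "Exi \<phi> \<in> H" for \<phi>
  proof -
    have "consistent (insert (Exi \<phi>) H)"
      using cons that by (simp add: insert_absorb)
    from step[OF this] have "\<exists>x. inst x \<phi> \<in> henkin_chain \<Gamma> (Suc (to_nat (Exi \<phi>)))"
      by (auto simp: Let_def)
    then show ?thesis using chain by blast
  qed
  with cons max have "saturated H" unfolding saturated_def by blast
  moreover have "\<Gamma> \<subseteq> H" using chain[of 0] by simp
  ultimately show thesis by (rule that)
qed

section \<open>The term model of a saturated set\<close>

context
  fixes H :: "'b fm set"
  assumes sat: "saturated H"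
begin

lemma saturated_derives_iff: "derives Classical H \<phi> \<longleftrightarrow> \<phi> \<in> H"
proof
  assume der: "derives Classical H \<phi>"
  have "consistent (insert \<phi> H)"
  proof (rule ccontr)
    assume "\<not> ?thesis"
    then have "derives Classical H \<^bold>\<bottom>"
      using der by (auto simp: inconsistent_insert_iff intro: derives.ImpE)
    then show False using sat by (simp add: saturated_def consistent_def)
  qed
  then show "\<phi> \<in> H" using sat by (simp add: saturated_def)
qed (rule derives.Hyp)

lemma saturated_Falsum: "\<^bold>\<bottom> \<notin> H"
  using sat derives.Hyp[of "\<^bold>\<bottom>" H] by (auto simp: saturated_def consistent_def)

lemma saturated_neg_iff: "(\<^bold>\<not> \<phi>) \<in> H \<longleftrightarrow> \<phi> \<notin> H"
proof
  assume "(\<^bold>\<not> \<phi>) \<in> H"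
  then show "\<phi> \<notin> H"
    using derives.ImpE[OF derives.Hyp derives.Hyp] saturated_derives_iff saturated_Falsum by blast
next
  assume "\<phi> \<notin> H"
  then have "consistent (insert (\<^bold>\<not> \<phi>) H)"
    by (simp add: consistent_insert_neg_iff saturated_derives_iff)
  then show "(\<^bold>\<not> \<phi>) \<in> H" using sat by (simp add: saturated_def)
qed

lemma saturated_Con_iff: "(\<phi> \<^bold>\<and> \<psi>) \<in> H \<longleftrightarrow> \<phi> \<in> H \<and> \<psi> \<in> H"
  unfolding saturated_derives_iff[symmetric]
  using derives.ConI[of Classical H \<phi> \<psi>] derives.ConE1[of Classical H \<phi> \<psi>]
    derives.ConE2[of Classical H \<phi> \<psi>] by blast

lemma saturated_Imp_iff: "(\<phi> \<^bold>\<longrightarrow> \<psi>) \<in> H \<longleftrightarrow> (\<phi> \<in> H \<longrightarrow> \<psi> \<in> H)"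
proof (intro iffI impI)
  assume "(\<phi> \<^bold>\<longrightarrow> \<psi>) \<in> H" "\<phi> \<in> H"
  then show "\<psi> \<in> H"
    unfolding saturated_derives_iff[symmetric] by (rule derives.ImpE)
next
  assume imp: "\<phi> \<in> H \<longrightarrow> \<psi> \<in> H"
  show "(\<phi> \<^bold>\<longrightarrow> \<psi>) \<in> H"
  proof (cases "\<phi> \<in> H")
    case True
    with imp have "derives Classical H \<psi>" by (simp add: saturated_derives_iff)
    then show ?thesis
      unfolding saturated_derives_iff[symmetric] by (rule derives.ImpI[OF derives_insert])
  next
    case False
    then have "derives Classical H (\<^bold>\<not> \<phi>)"
      by (simp add: saturated_derives_iff saturated_neg_iff)
    from derives.ImpE[OF derives_insert[OF this] derives_Hyp0] show ?thesis
      unfolding saturated_derives_iff[symmetric] by (rule derives.ImpI[OF derives.FalsumE])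
  qed
qed

lemma saturated_Dis_iff: "(\<phi> \<^bold>\<or> \<psi>) \<in> H \<longleftrightarrow> \<phi> \<in> H \<or> \<psi> \<in> H"
proof
  assume dis: "(\<phi> \<^bold>\<or> \<psi>) \<in> H"
  show "\<phi> \<in> H \<or> \<psi> \<in> H"
  proof (rule ccontr)
    assume "\<not> ?thesis"
    then have "derives Classical H (\<^bold>\<not> \<phi>)" "derives Classical H (\<^bold>\<not> \<psi>)"
      by (simp_all add: saturated_derives_iff saturated_neg_iff)
    then have "derives Classical (insert \<phi> H) \<^bold>\<bottom>" "derives Classical (insert \<psi> H) \<^bold>\<bottom>"
      by (meson derives.ImpE derives_Hyp0 derives_insert)+
    from derives.DisE[OF derives.Hyp[OF dis] this] show False
      by (simp add: saturated_derives_iff saturated_Falsum)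
  qed
next
  assume "\<phi> \<in> H \<or> \<psi> \<in> H"
  then show "(\<phi> \<^bold>\<or> \<psi>) \<in> H"
    unfolding saturated_derives_iff[symmetric] by (blast intro: derives.DisI1 derives.DisI2)
qed

lemma saturated_Exi_iff: "Exi \<phi> \<in> H \<longleftrightarrow> (\<exists>x. inst x \<phi> \<in> H)"
proof
  assume "Exi \<phi> \<in> H"
  then show "\<exists>x. inst x \<phi> \<in> H" using sat by (simp add: saturated_def)
next
  assume "\<exists>x. inst x \<phi> \<in> H"
  then show "Exi \<phi> \<in> H"
    unfolding saturated_derives_iff[symmetric] by (blast intro: derives.ExiI)
qed

text \<open>Saturation supplies witnesses for existentials only, so the converse passes through the
  absence of a counterexample and double negation elimination.\<close>

lemma saturated_Uni_iff: "Uni \<phi> \<in> H \<longleftrightarrow> (\<forall>x. inst x \<phi> \<in> H)"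
proof
  assume "Uni \<phi> \<in> H"
  then show "\<forall>x. inst x \<phi> \<in> H"
    unfolding saturated_derives_iff[symmetric] by (blast intro: derives.UniE)
next
  assume all: "\<forall>x. inst x \<phi> \<in> H"
  have "Exi (\<^bold>\<not> \<phi>) \<notin> H"
    using all by (simp add: saturated_Exi_iff inst_Imp_Falsum saturated_neg_iff)
  then have H: "(\<^bold>\<not> Exi (\<^bold>\<not> \<phi>)) \<in> H" by (simp add: saturated_neg_iff)
  let ?\<Delta> = "insert (\<^bold>\<not> \<phi>) (ren Suc ` H)"
  \<comment> \<open>In the shifted context the eigenvariable 0 is itself a counterexample,
    contradicting the shifted hypothesis \<open>H\<close>.\<close>
  have "derives Classical ?\<Delta> (inst 0 (ren (lift Suc) (\<^bold>\<not> \<phi>)))"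
    by (simp add: inst_0_ren_lift_Suc derives_Hyp0 del: ren.simps)
  then have "derives Classical ?\<Delta> (Exi (ren (lift Suc) (\<^bold>\<not> \<phi>)))" by (rule derives.ExiI)
  moreover have "ren Suc (\<^bold>\<not> Exi (\<^bold>\<not> \<phi>)) \<in> ren Suc ` H" using H by (rule imageI)
  then have "derives Classical ?\<Delta> (\<^bold>\<not> Exi (ren (lift Suc) (\<^bold>\<not> \<phi>)))"
    by (intro derives.Hyp) simp
  ultimately have "derives Classical ?\<Delta> \<^bold>\<bottom>" by (rule derives.ImpE[rotated])
  then have "derives Classical (ren Suc ` H) \<phi>" by (rule derives.DNE[OF refl derives.ImpI])
  then show "Uni \<phi> \<in> H"
    unfolding saturated_derives_iff[symmetric] by (rule derives.UniI)
qed

lemma saturated_Eql_refl: "(x \<^bold>= x) \<in> H"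
  unfolding saturated_derives_iff[symmetric] by (rule derives.EqlI)

lemma saturated_Eql_subst: "(x \<^bold>= y) \<in> H \<Longrightarrow> inst x \<phi> \<in> H \<Longrightarrow> inst y \<phi> \<in> H"
  unfolding saturated_derives_iff[symmetric] by (rule derives.EqlE)

text \<open>The place to be replaced is index 0 of the substituted formula; all other variables
  carry a \<open>Suc\<close> that \<open>inst\<close> strips. The next lemmas follow this pattern,
  one argument at a time.\<close>

lemma saturated_Eql_sym: "(x \<^bold>= y) \<in> H \<Longrightarrow> (y \<^bold>= x) \<in> H"
  using saturated_Eql_subst[of x y "0 \<^bold>= Suc x"] saturated_Eql_refl[of x] by (simp add: inst_def)

lemma saturated_Eql_trans: "(x \<^bold>= y) \<in> H \<Longrightarrow> (y \<^bold>= z) \<in> H \<Longrightarrow> (x \<^bold>= z) \<in> H"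
  using saturated_Eql_subst[of y z "Suc x \<^bold>= 0"] by (simp add: inst_def)

lemma saturated_Betw_cong:
  assumes "(x \<^bold>= x') \<in> H" "(y \<^bold>= y') \<in> H" "(z \<^bold>= z') \<in> H" "Betw r x y z \<in> H"
  shows "Betw r x' y' z' \<in> H"
  using saturated_Eql_subst[of x x' "Betw r 0 (Suc y) (Suc z)"]
    saturated_Eql_subst[of y y' "Betw r (Suc x') 0 (Suc z)"]
    saturated_Eql_subst[of z z' "Betw r (Suc x') (Suc y') 0"] assms
  by (simp add: inst_def)

lemma saturated_Cong_cong:
  assumes "(x \<^bold>= x') \<in> H" "(y \<^bold>= y') \<in> H" "(z \<^bold>= z') \<in> H" "(w \<^bold>= w') \<in> H" "Cong x y z w \<in> H"
  shows "Cong x' y' z' w' \<in> H"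
  using saturated_Eql_subst[of x x' "Cong 0 (Suc y) (Suc z) (Suc w)"]
    saturated_Eql_subst[of y y' "Cong (Suc x') 0 (Suc z) (Suc w)"]
    saturated_Eql_subst[of z z' "Cong (Suc x') (Suc y') 0 (Suc w)"]
    saturated_Eql_subst[of w w' "Cong (Suc x') (Suc y') (Suc z') 0"] assms
  by (simp add: inst_def)

text \<open>Environments have the form \<open>cls \<circ> f\<close>, so assignments are renamings; a
  quantifier over points becomes one over variables since \<open>cls\<close> is onto.
  \<open>cls\<close> is abstract because the type of points is introduced only later.\<close>

lemma truth_lemma:
  fixes cls :: "nat \<Rightarrow> 'a"
  assumes surj: "surj cls" and cls: "\<And>x y. cls x = cls y \<longleftrightarrow> (x \<^bold>= y) \<in> H"
  defines "I \<equiv> (\<lambda>r a b c. \<exists>x y z. a = cls x \<and> b = cls y \<and> c = cls z \<and> Betw r x y z \<in> H)"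
    and "C \<equiv> (\<lambda>a b c d. \<exists>x y z w. a = cls x \<and> b = cls y \<and> c = cls z \<and> d = cls w \<and> Cong x y z w \<in> H)"
  shows "sat I C (cls \<circ> f) \<phi> \<longleftrightarrow> ren f \<phi> \<in> H"
proof (induction \<phi> arbitrary: f)
  case (Betw r x y z)
  show ?case
    unfolding sat.simps ren.simps I_def comp_def cls
    by (meson saturated_Betw_cong saturated_Eql_refl saturated_Eql_sym)
next
  case (Cong x y z w)
  show ?case
    unfolding sat.simps ren.simps C_def comp_def cls
    by (meson saturated_Cong_cong saturated_Eql_refl saturated_Eql_sym)
next
  case (Uni \<phi>)
  have IH: "sat I C (case_nat (cls x) (cls \<circ> f)) \<phi> \<longleftrightarrow> inst x (ren (lift f) \<phi>) \<in> H" for x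
    unfolding case_nat_comp inst_ren_lift by (rule Uni.IH)
  have "(\<forall>d. sat I C (case_nat d (cls \<circ> f)) \<phi>) \<longleftrightarrow> (\<forall>x. sat I C (case_nat (cls x) (cls \<circ> f)) \<phi>)"
    using surj by (metis surjD)
  then show ?case unfolding sat.simps ren.simps saturated_Uni_iff IH .
next
  case (Exi \<phi>)
  have IH: "sat I C (case_nat (cls x) (cls \<circ> f)) \<phi> \<longleftrightarrow> inst x (ren (lift f) \<phi>) \<in> H" for x
    unfolding case_nat_comp inst_ren_lift by (rule Exi.IH)
  have "(\<exists>d. sat I C (case_nat d (cls \<circ> f)) \<phi>) \<longleftrightarrow> (\<exists>x. sat I C (case_nat (cls x) (cls \<circ> f)) \<phi>)"
    using surj by (metis surjD)
  then show ?case unfolding sat.simps ren.simps saturated_Exi_iff IH .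
qed (simp_all add: cls saturated_Falsum saturated_Con_iff saturated_Dis_iff saturated_Imp_iff)

end

section \<open>Circles and lines\<close>

text \<open>This is the setting in which segment-circle continuity is derived from the line-circle
  axiom. Collinearity is spelled out in the form to which \<open>Col\<close> simplifies in a
  model.\<close>

locale line_circle_geometry =
  fixes T :: "'a \<Rightarrow> 'a \<Rightarrow> 'a \<Rightarrow> bool" and E :: "'a \<Rightarrow> 'a \<Rightarrow> 'a \<Rightarrow> 'a \<Rightarrow> bool"
  assumes E_swap: "E a b b a"
    and E_euclid: "E a b p q \<Longrightarrow> E a b r s \<Longrightarrow> E p q r s"
    and E_identity: "E a b c c \<Longrightarrow> a = b"
    and segment_construction: "\<exists>x. T q a x \<and> E a x b c"
    and five_segment: "a \<noteq> b \<Longrightarrow> T a b c \<Longrightarrow> T a' b' c' \<Longrightarrow> E a b a' b' \<Longrightarrow> E b c b' c' \<Longrightarrow>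
      E a d a' d' \<Longrightarrow> E b d b' d' \<Longrightarrow> E c d c' d'"
    and T_identity: "T a b a \<Longrightarrow> a = b"
    and pasch: "T a p c \<Longrightarrow> T b q c \<Longrightarrow> \<exists>x. T p x b \<and> T q x a"
    and line_circle: "T p u v \<or> T u p v \<or> T u v p \<Longrightarrow> u \<noteq> v \<Longrightarrow> T a p b \<Longrightarrow>
      \<exists>y z. (T y u v \<or> T u y v \<or> T u v y) \<and> (T z u v \<or> T u z v \<or> T u v z) \<and>
        E a y a b \<and> E a z a b \<and> T y p z \<and> (p \<noteq> b \<longrightarrow> y \<noteq> z)"
begin

text \<open>Congruence of segments becomes equality of their classes.\<close>

definition len :: "'a \<Rightarrow> 'a \<Rightarrow> ('a \<times> 'a) set" where
  "len a b = {(c, d). E a b c d}"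

lemma E_iff_len: "E a b c d \<longleftrightarrow> len a b = len c d"
proof -
  have refl: "E a b a b" for a b
    using E_swap E_euclid by blast
  then have "E a b c d \<Longrightarrow> E c d a b" for a b c d
    using E_euclid by blast
  with refl show ?thesis
    unfolding len_def using E_euclid by blast
qed

lemma len_commute: "len a b = len b a"
  using E_swap E_iff_len by blast

text \<open>A segment congruent to \<open>b b\<close> laid off from \<open>a\<close> must end at
  \<open>a\<close>.\<close>

lemma len_self: "len a a = len b b"
  by (metis E_identity E_iff_len segment_construction)

lemma len_eq_self_iff: "len a b = len c c \<longleftrightarrow> a = b" "len c c = len a b \<longleftrightarrow> a = b"
  by (metis E_identity E_iff_len len_self)+

lemma extend: obtains x where "T q a x" "len a x = len b c"
  using segment_construction E_iff_len by metis

lemma five_segment_len: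
  assumes "a \<noteq> b" "T a b c" "T a' b' c'" "len a b = len a' b'" "len b c = len b' c'"
    "len a d = len a' d'" "len b d = len b' d'"
  shows "len c d = len c' d'"
  using five_segment[of a b c a' b' c' d d'] assms by (simp add: E_iff_len)

section \<open>Order and congruence on a line\<close>

lemma T_triv [simp]: "T a b b"
  by (metis extend len_eq_self_iff)

text \<open>The configuration is chosen so that the point given by Pasch's axiom lies between
  \<open>b\<close> and \<open>b\<close> and is therefore \<open>b\<close>; \<open>T_inner\<close>
  repeats this.\<close>

lemma T_sym: "T a b c \<Longrightarrow> T c b a"
  using pasch[of a b c b c] T_identity T_triv by blast

lemma T_triv' [simp]: "T a a b"
  using T_sym T_triv by blast

lemma T_inner: "T a b d \<Longrightarrow> T b c d \<Longrightarrow> T a b c"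
  using pasch[of a b d b c] T_identity T_sym by blast

lemma T_exchange: "T a b c \<Longrightarrow> T a c d \<Longrightarrow> T b c d"
  using T_inner T_sym by blast

text \<open>The five-segment axiom with the initial points \<open>a\<close> and \<open>a'\<close>
  themselves as apexes.\<close>

lemma len_add:
  assumes "T a b c" "T a' b' c'" "len a b = len a' b'" "len b c = len b' c'"
  shows "len a c = len a' c'"
proof (cases "a = b")
  case True
  then have "a' = b'"
    using assms(3) len_eq_self_iff(2) by blast
  with True assms(4) show ?thesis by blast
next
  case False
  then have "len c a = len c' a'"
    by (smt (verit) five_segment_len[of a b c a' b' c' a a'] assms len_self[of a a'] len_commute)
  then show ?thesis using len_commute[of c a] len_commute[of c' a'] by argo
qed

text \<open>The five-segment axiom compares \<open>x\<close> with itself, once seen from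
  \<open>x\<close> and once from \<open>y\<close>.\<close>

lemma extend_unique:
  assumes "q \<noteq> a" "T q a x" "T q a y" "len a x = len a y"
  shows "x = y"
proof -
  have "len q x = len q y"
    using len_add[of q a x q a y] assms by blast
  then have "len x x = len x y"
    using five_segment_len[of q a x q a x x y] assms by blast
  then show ?thesis by (simp add: len_eq_self_iff)
qed

text \<open>From a point \<open>w\<close> beyond \<open>a\<close>, both \<open>b\<close> and
  \<open>c\<close> prolong \<open>w a\<close> by the same length.\<close>

lemma T_len_eq:
  assumes "T a b c" "len a b = len a c"
  shows "b = c"
proof -
  obtain w where w: "T c a w" "len a w = len a c"
    using extend .
  show ?thesis
  proof (cases "a = c")
    case True
    then show ?thesis using assms T_identity by blast
  next
    case False
    then have "w \<noteq> a" using w by (metis len_eq_self_iff(2))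
    moreover have "T w a c" using w T_sym by blast
    moreover have "T w a b" using T_inner[of w a c b] \<open>T w a c\<close> assms by blast
    ultimately show ?thesis using extend_unique assms by blast
  qed
qed

text \<open>Prolonging \<open>a c\<close> by the length of \<open>c d\<close> gives a point that
  also prolongs \<open>b c\<close>, and that point is unique.\<close>

lemma T_outer_right:
  assumes "T a b c" "T b c d" "b \<noteq> c"
  shows "T a c d"
proof -
  obtain x where x: "T a c x" "len c x = len c d"
    using extend .
  then have "T b c x" using T_exchange[of a b c x] assms(1) by blast
  then have "x = d" using extend_unique x assms by blast
  with x show ?thesis by simp
qed

lemma T_outer_left: "T a b c \<Longrightarrow> T b c d \<Longrightarrow> b \<noteq> c \<Longrightarrow> T a b d"
  using T_outer_right[of d c b a] T_sym[of a b c] T_sym[of b c d] T_sym[of d b a] by simp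

lemma T_inner_trans: "T a b d \<Longrightarrow> T b c d \<Longrightarrow> T a c d"
  using T_outer_right[of a b c d] T_inner[of a b d c] by (cases "b = c") simp_all

lemma T_trans: "T a b c \<Longrightarrow> T a c d \<Longrightarrow> T a b d"
  using T_inner_trans[of d c a b] T_sym[of a b c] T_sym[of a c d] T_sym[of d b a] by simp

lemma T_antisym: "T a b c \<Longrightarrow> T a c b \<Longrightarrow> b = c"
  using T_exchange[of a b c b] T_identity by blast

text \<open>The outer five-segment axiom is applied twice: forward to a point \<open>e\<close>
  beyond \<open>c\<close>, then from \<open>e\<close> back through \<open>c\<close> to
  \<open>b\<close>.\<close>

lemma inner_five_segment:
  assumes "T a b c" "T a' b' c'" "len a c = len a' c'" "len b c = len b' c'"
    "len a d = len a' d'" "len c d = len c' d'"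
  shows "len b d = len b' d'"
proof (cases "a = c")
  case True
  then have "a' = c'" using assms(3) by (metis len_eq_self_iff(2))
  with True assms show ?thesis using T_identity by blast
next
  case False
  obtain e where e: "T a c e" "len c e = len a c" using extend .
  obtain e' where e': "T a' c' e'" "len c' e' = len a' c'" using extend .
  have ne: "e \<noteq> c" using e False by (metis len_eq_self_iff(2))
  have "len e d = len e' d'"
    using five_segment_len[of a c e a' c' e' d d'] False e e' assms by simp
  moreover have "T e c b" "T e' c' b'"
    using T_sym[OF T_exchange[OF assms(1) e(1)]] T_sym[OF T_exchange[OF assms(2) e'(1)]] .
  ultimately show ?thesis
    using five_segment_len[of e c b e' c' b' d d'] ne e e' assms by (simp add: len_commute)
qed

text \<open>Both rays are prolonged to the total length of \<open>a p\<close> and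
  \<open>a q\<close>, so that \<open>x\<close>, \<open>y\<close>, \<open>x'\<close>,
  \<open>y'\<close> are equally far from \<open>a\<close>. Two inner five-segment steps carry the
  result back to \<open>p\<close> and \<open>q\<close>.\<close>

lemma len_point_reflection:
  assumes "T p a p'" "len a p = len a p'" "T q a q'" "len a q = len a q'"
  shows "len p q = len p' q'"
proof (cases "p = a \<or> q = a")
  case True
  then show ?thesis using assms by (metis len_eq_self_iff(2) len_commute)
next
  case False
  then have ne: "p \<noteq> a" "q \<noteq> a" "p' \<noteq> a" "q' \<noteq> a"
    using assms by (metis len_eq_self_iff)+
  obtain x where x: "T a p x" "len p x = len a q" using extend .
  obtain y where y: "T a q y" "len q y = len a p" using extend .
  obtain x' where x': "T a p' x'" "len p' x' = len a q" using extend .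
  obtain y' where y': "T a q' y'" "len q' y' = len a p" using extend .
  have "T x a x'" "T y a y'"
    using T_outer_left T_outer_right T_sym assms x x' y y' ne by meson+
  moreover have xa: "x \<noteq> a" using x ne T_identity by blast
  moreover have ax': "len a x = len a x'"
    using len_add[of a p x a p' x'] x x' assms by simp
  moreover have ay': "len a y = len a y'"
    using len_add[of a q y a q' y'] y y' assms by simp
  moreover have "len a x = len y a"
    using len_add[of a p x y q a] x y T_sym by (simp add: len_commute)
  \<comment> \<open>Compares the line \<open>x a x'\<close> with \<open>y' a y\<close>, where the
    apex of each is the first end of the other.\<close>
  ultimately have xy: "len x' y' = len y x"
    by (smt (verit) five_segment_len[of x a x' y' a y y' x] len_commute T_sym)
  have "len p y = len p' y'"
    using inner_five_segment[of a p x a p' x' y y'] x x' ax' ay' xy by (simp add: len_commute)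
  then have "len q p = len q' p'"
    using inner_five_segment[of a q y a q' y' p p'] y y' ay' assms by (simp add: len_commute)
  then show ?thesis by (simp add: len_commute)
qed

section \<open>Points of a line on a circle\<close>

lemma equidistant_between:
  assumes "T a c b" "len a c = len a c'" "len b c = len b c'"
  shows "c = c'"
proof -
  have "len c c' = len c c"
    by (rule inner_five_segment[of a c b a c b]) (simp_all add: assms(1) assms(2,3)[symmetric])
  then show ?thesis by (simp add: len_eq_self_iff)
qed

text \<open>Reflection in \<open>m\<close> takes \<open>a\<close> to \<open>a'\<close> and
  \<open>u\<close> to \<open>z\<close>. Hence \<open>z\<close> has the same distances from
  \<open>a\<close> and \<open>a'\<close> as \<open>m\<close>, which lies between them.\<close>

lemma circle_line_midpoint:
  assumes "T u m z" "len m u = len m z" "len a u = len a m" "len a z = len a m"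
  shows "m = z"
proof -
  obtain a' where a': "T a m a'" "len m a' = len m a" using extend .
  have "len a u = len a' z"
    using len_point_reflection[of a m a' u z, OF a'(1) a'(2)[symmetric]] assms(1,2) len_commute by metis
  then have "len a' m = len a' z"
    using a' assms(3) len_commute by metis
  then show ?thesis
    using equidistant_between a'(1) assms(4) by metis
qed

text \<open>The five-segment axiom for \<open>z q y\<close> and \<open>q z v\<close>, and again for \<open>y q v\<close> and \<open>q y u\<close>, shows
  that \<open>v\<close> and \<open>u\<close> lie on the circle as well; \<open>y\<close> is the midpoint of \<open>u\<close> and \<open>z\<close>.\<close>

lemma circle_line_three_points:
  assumes "T y q z" "len a y = len a q" "len a z = len a q"
  shows "q = y \<or> q = z"
proof (rule ccontr)
  assume "\<not> ?thesis"
  then have ne: "q \<noteq> y" "q \<noteq> z" by auto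
  obtain v where v: "T q z v" "len z v = len y q" using extend .
  obtain u where u: "T q y u" "len y u = len q v" using extend .
  have "len y a = len v a"
    by (smt (verit) five_segment_len[of z q y q z v a a] ne v assms T_sym len_commute)
  moreover have "T y q v"
    using T_outer_left assms v ne by blast
  ultimately have "len v a = len u a"
    by (smt (verit) five_segment_len[of y q v q y u a a] ne u assms len_commute)
  moreover have "len q v = len z y"
    by (smt (verit) len_add[of q z v z q y] v assms T_sym len_commute)
  moreover have "T u y z"
    using T_outer_left[of u y q z] u ne assms T_sym by blast
  ultimately have "y = z"
    by (smt (verit) circle_line_midpoint[of u y z a] \<open>len y a = len v a\<close> u assms len_commute)
  then show False using T_identity assms ne by blast
qed

text \<open>Points at equal distance on the rays from \<open>p\<close> through \<open>y\<close> and \<open>z\<close> both extend \<open>q p\<close>, hence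
  coincide.\<close>

lemma no_tripod:
  assumes "T q p y" "T q p z" "T y p z"
  shows "p = q \<or> p = y \<or> p = z"
proof (rule ccontr)
  assume "\<not> ?thesis"
  then have ne: "p \<noteq> q" "p \<noteq> y" "p \<noteq> z" by auto
  obtain y' where y': "T p y y'" "len y y' = len p z" using extend .
  obtain z' where z': "T p z z'" "len z z' = len p y" using extend .
  have "len p y' = len p z'"
    by (smt (verit) len_add[of p y y' z' z p] y' z' T_sym len_commute)
  moreover have "T q p y'" "T q p z'"
    using T_outer_left assms y' z' ne by blast+
  ultimately have "y' = z'"
    using extend_unique ne by metis
  moreover have "T y' p z'"
    using T_outer_left T_outer_right T_sym assms(3) y' z' ne by meson
  ultimately show False using T_identity ne y' by metis
qed

text \<open>The line through \<open>y\<close>, \<open>z\<close> meets the larger circle through \<open>q\<close> in \<open>s\<close> on the far side of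
  \<open>y\<close> and in \<open>t\<close>; if \<open>t\<close> does not lie between \<open>y\<close> and \<open>z\<close>, then \<open>q\<close> is a third point of
  that circle on the line.\<close>

lemma larger_circle_chord:
  assumes q: "T y q z" "q \<noteq> z" and len: "len a y = len a b"
    and b: "T a b c" "len a c = len a q" "b \<noteq> c" and "a \<noteq> b"
  obtains s t where "T s y t" "T y t z" "s \<noteq> y" "t \<noteq> y" "s \<noteq> t" "len a s = len a q" "len a t = len a q"
proof -
  have ay: "a \<noteq> y" using assms by (metis len_eq_self_iff(2))
  have yz: "y \<noteq> z" using q T_identity by blast
  \<comment> \<open>Prolongs \<open>a y\<close> to the radius \<open>a q\<close>, which exhibits
    \<open>y\<close> as an inner point of the larger circle.\<close>
  obtain y' where y': "T a y y'" "len y y' = len b c" using extend .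
  have "len a y' = len a q"
    using len_add[OF y'(1) b(1)] len y' b by simp
  moreover have "y \<noteq> y'" using y' b by (metis len_eq_self_iff(2))
  ultimately obtain s t where st: "T s y z \<or> T y s z \<or> T y z s" "T t y z \<or> T y t z \<or> T y z t"
      "len a s = len a q" "len a t = len a q" "T s y t" "s \<noteq> t"
    using line_circle[of y y z a y'] yz y' by (auto simp: E_iff_len)
  have lne: "len a y \<noteq> len a q"
  proof
    assume "len a y = len a q"
    then have "len a b = len a c" using b len by simp
    then show False using T_len_eq b by blast
  qed
  then have ne: "s \<noteq> y" "t \<noteq> y" using st by auto
  have qy: "q \<noteq> y" using lne by auto
  have key: "T y t z" if "T s y t" "s \<noteq> y" "t \<noteq> y" "s \<noteq> t" "len a s = len a q" "len a t = len a q"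
    "T y t z \<or> T y z t" for s t
  proof (rule ccontr)
    assume "\<not> ?thesis"
    then have "T y z t" using that by blast
    then have "T y q t" using T_trans q by blast
    then have "T s q t" using T_inner_trans that by blast
    then have "q = s \<or> q = t"
      using circle_line_three_points that by auto
    moreover have "q \<noteq> t" using \<open>T y z t\<close> q T_antisym by blast
    moreover have "q \<noteq> s" using \<open>T s y t\<close> \<open>T y q t\<close> \<open>s \<noteq> y\<close> T_antisym T_sym by metis
    ultimately show False by blast
  qed
  \<comment> \<open>\<open>s\<close> and \<open>t\<close> lie on opposite sides of \<open>y\<close>,
    so \<open>z\<close> is on the same side as one of them.\<close>
  have "\<not> (T z y s \<and> T z y t)"
    using no_tripod[of z y s t] st ne yz by blast
  then consider "T y t z \<or> T y z t" | "T y s z \<or> T y z s"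
    using st T_sym by blast
  then show thesis
  proof cases
    case 1
    then show thesis using that key st ne by blast
  next
    case 2
    then show thesis using that[of t s] key[of t s] st ne T_sym by metis
  qed
qed

text \<open>Otherwise the circle through \<open>q\<close> is larger, and
  \<open>larger_circle_chord\<close> applied at both ends yields its points \<open>s\<close> beyond
  \<open>y\<close>, \<open>t\<close> on the chord and \<open>s'\<close> beyond \<open>z\<close>:
  three points of one circle in order on a line.\<close>

lemma chord_inside_circle:
  assumes "T y q z" "len a y = len a b" "len a z = len a b"
    and c: "T a b c" "len a c = len a q"
  shows "q = y \<or> q = z"
proof (rule ccontr)
  assume "\<not> ?thesis"
  then have q: "q \<noteq> y" "q \<noteq> z" by auto
  have "b \<noteq> c" using circle_line_three_points assms q by metis
  have "y \<noteq> z" using q assms(1) T_identity by blast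
  have "a \<noteq> b" using assms \<open>y \<noteq> z\<close> by (metis len_eq_self_iff(2))
  obtain s t where st: "T s y t" "T y t z" "s \<noteq> y" "t \<noteq> y" "s \<noteq> t"
      "len a s = len a q" "len a t = len a q"
    using larger_circle_chord[of y q z a b c] assms q \<open>b \<noteq> c\<close> \<open>a \<noteq> b\<close> by metis
  obtain s' t' where st': "T s' z t'" "T z t' y" "s' \<noteq> z" "t' \<noteq> z" "s' \<noteq> t'"
      "len a s' = len a q" "len a t' = len a q"
    using larger_circle_chord[of z q y a b c] assms q \<open>b \<noteq> c\<close> \<open>a \<noteq> b\<close> T_sym by metis
  have "T s t z" using T_outer_right st by blast
  moreover have "T y z s'" using T_outer_left[of s' z t' y] st' T_sym by blast
  then have "T t z s'" using T_exchange st by blast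
  moreover have "t \<noteq> z"
  proof
    assume "t = z"
    then have "len a y = len a q" "len a z = len a q" using st assms by simp_all
    then show False using circle_line_three_points assms(1) q by blast
  qed
  ultimately have "T s t s'" using T_outer_left by blast
  then have "t = s'"
    using circle_line_three_points[of s t s' a] st st' by auto
  then show False using \<open>T t z s'\<close> T_identity \<open>s' \<noteq> z\<close> by blast
qed

theorem segment_circle:
  assumes "E a x a p" "T a x b" "T a b y" "E a y a q"
  shows "\<exists>z. T p z q \<and> E a z a b"
proof (rule ccontr)
  assume no: "\<not> ?thesis"
  have len: "len a x = len a p" "len a y = len a q" using assms E_iff_len by auto
  have np: "len a p \<noteq> len a b" and nq: "len a q \<noteq> len a b"
    using no E_iff_len T_triv T_triv' by metis+
  \<comment> \<open>If \<open>p = q\<close>, the radius \<open>a b\<close> is squeezed between two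
    equal lengths.\<close>
  have pq: "p \<noteq> q"
  proof
    assume "p = q"
    have "T a x y" using T_trans assms by blast
    moreover have "len a x = len a y" using len \<open>p = q\<close> by simp
    ultimately have "x = y" using T_len_eq by blast
    then have "x = b" using T_antisym assms by blast
    then show False using np len by simp
  qed
  \<comment> \<open>Prolongs \<open>a p\<close> to the radius \<open>a b\<close>, as the line-circle
    axiom requires for the inner point \<open>p\<close>.\<close>
  obtain b' where b': "T a p b'" "len p b' = len x b" using extend .
  have ab': "len a b' = len a b" using len_add[of a p b' a x b] assms b' len by simp
  then obtain s t where st: "T s p q \<or> T p s q \<or> T p q s" "T t p q \<or> T p t q \<or> T p q t"
      "len a s = len a b" "len a t = len a b" "T s p t"
    using line_circle[of p p q a b'] pq b' by (auto simp: E_iff_len)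
  have out: "\<not> T p s q" "\<not> T p t q" using no st E_iff_len by blast+
  have ne: "s \<noteq> p" "t \<noteq> p" "s \<noteq> q" "t \<noteq> q" using np nq st by auto
  \<comment> \<open>Were \<open>q\<close> between \<open>p\<close> and an intersection point, it
    would lie on a chord although \<open>a q\<close> is at least the radius.\<close>
  have "\<not> T p q t" if "T s p t" "len a s = len a b" "len a t = len a b" for s t
  proof
    assume "T p q t"
    then have "T s q t" using T_inner_trans that by blast
    then show False
      using chord_inside_circle[of s q t a b y] that assms nq len by auto
  qed
  then have "\<not> T p q t" "\<not> T p q s" using st T_sym by blast+
  \<comment> \<open>Both intersection points are now on the far side of \<open>p\<close> from
    \<open>q\<close>, yet \<open>p\<close> separates them.\<close>
  then have "T q p s" "T q p t" using st out T_sym by blast+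
  then show False using no_tripod[of q p s t] st ne pq by blast
qed

end

section \<open>Models of intuitionistic Tarski geometry\<close>

text \<open>Binding a named variable amounts to updating the environment at that name, so the axioms
  can be read off in their named form.\<close>

lemma sat_Uni_bind: "sat I C e (Uni (bind x \<phi>)) \<longleftrightarrow> (\<forall>d. sat I C (e(x := d)) \<phi>)"
proof -
  have "case_nat d e \<circ> (\<lambda>y. if y = x then 0 else Suc y) = e(x := d)" for d
    by (auto simp: fun_eq_iff)
  then show ?thesis by (simp add: bind_def sat_ren)
qed

lemma sat_Exi_bind: "sat I C e (Exi (bind x \<phi>)) \<longleftrightarrow> (\<exists>d. sat I C (e(x := d)) \<phi>)"
proof -
  have "case_nat d e \<circ> (\<lambda>y. if y = x then 0 else Suc y) = e(x := d)" for d
    by (auto simp: fun_eq_iff)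
  then show ?thesis by (simp add: bind_def sat_ren)
qed

lemma sat_all_vars [simp]:
  "sat I C e (\<^bold>\<forall>[]\<^bold>. \<phi>) \<longleftrightarrow> sat I C e \<phi>"
  "sat I C e (\<^bold>\<forall>x # xs\<^bold>. \<phi>) \<longleftrightarrow> (\<forall>d. sat I C (e(x := d)) (\<^bold>\<forall>xs\<^bold>. \<phi>))"
  by (simp_all add: all_vars_def sat_Uni_bind del: sat.simps)

lemma sat_ex_vars [simp]:
  "sat I C e (\<^bold>\<exists>[]\<^bold>. \<phi>) \<longleftrightarrow> sat I C e \<phi>"
  "sat I C e (\<^bold>\<exists>x # xs\<^bold>. \<phi>) \<longleftrightarrow> (\<exists>d. sat I C (e(x := d)) (\<^bold>\<exists>xs\<^bold>. \<phi>))"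
  by (simp_all add: ex_vars_def sat_Exi_bind del: sat.simps)

text \<open>The classical reading of the doubly negated definition of \<open>T\<close> from
  \<open>B\<close>.\<close>

definition nonstrict_of :: "('a \<Rightarrow> 'a \<Rightarrow> 'a \<Rightarrow> bool) \<Rightarrow> 'a \<Rightarrow> 'a \<Rightarrow> 'a \<Rightarrow> bool" where
  "nonstrict_of R a b c \<longleftrightarrow> a = b \<or> b = c \<or> R a b c"

definition both_betweenness :: "('a \<Rightarrow> 'a \<Rightarrow> 'a \<Rightarrow> bool) \<Rightarrow> betweenness \<Rightarrow> 'a \<Rightarrow> 'a \<Rightarrow> 'a \<Rightarrow> bool" where
  "both_betweenness R r = (case r of Strict \<Rightarrow> R | Nonstrict \<Rightarrow> nonstrict_of R)"

lemma both_betweenness_simps [simp]: "both_betweenness R Strict = R" "both_betweenness R Nonstrict = nonstrict_of R"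
  by (simp_all add: both_betweenness_def)

lemma sat_expand:
  assumes "\<And>e r x y z. sat I C e (d r x y z) \<longleftrightarrow> J r (e x) (e y) (e z)"
  shows "sat I C e (expand d \<phi>) \<longleftrightarrow> sat J C e \<phi>"
  by (induction \<phi> arbitrary: e) (simp_all add: assms)

lemma sat_to_B: "sat (\<lambda>_. R) C e (to_B \<phi>) \<longleftrightarrow> sat (both_betweenness R) C e \<phi>"
  unfolding to_B_def by (rule sat_expand) (auto simp: nonstrict_of_def split: betweenness.split)

text \<open>Distinctness lets the strict relation be recovered from its non-strict closure, so one
  structure interprets both languages.\<close>

lemma sat_to_T:
  assumes "\<And>a b c. R a b c \<Longrightarrow> a \<noteq> b \<and> b \<noteq> c"
  shows "sat (\<lambda>_. nonstrict_of R) C e (to_T \<phi>) \<longleftrightarrow> sat (both_betweenness R) C e \<phi>"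
  unfolding to_T_def
  by (rule sat_expand) (auto simp: nonstrict_of_def dest: assms split: betweenness.split)

locale intuitionistic_tarski_model =
  fixes R :: "'a \<Rightarrow> 'a \<Rightarrow> 'a \<Rightarrow> bool" and E :: "'a \<Rightarrow> 'a \<Rightarrow> 'a \<Rightarrow> 'a \<Rightarrow> bool"
  assumes model: "\<phi> \<in> intuitionistic_tarski \<Longrightarrow> sat (\<lambda>_. R) E e \<phi>"
begin

abbreviation betw :: "'a \<Rightarrow> 'a \<Rightarrow> 'a \<Rightarrow> bool" where
  "betw \<equiv> nonstrict_of R"

lemma sat_axioms:
  "sat (both_betweenness R) E e A1" "sat (both_betweenness R) E e A2" "sat (both_betweenness R) E e A3" "sat (both_betweenness R) E e A4_i"
  "sat (both_betweenness R) E e A5" "sat (both_betweenness R) E e A6_i" "sat (both_betweenness R) E e A7_i" "sat (both_betweenness R) E e A8"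
  "sat (both_betweenness R) E e A9" "sat (both_betweenness R) E e A10_3" "sat (both_betweenness R) E e A14_i" "sat (both_betweenness R) E e A15_i"
  "sat (both_betweenness R) E e two_point_line_circle"
  by (rule sat_to_B[THEN iffD1, OF model]; simp add: intuitionistic_tarski_def)+

lemma R_irrefl: "\<not> R a b a"
  using sat_axioms(6)[unfolded A6_i_def, simplified] by blast

lemma R_sym: "R a b c \<Longrightarrow> R c b a"
  using sat_axioms(11)[unfolded A14_i_def, simplified] by blast

lemma R_inner: "R a b d \<Longrightarrow> R b c d \<Longrightarrow> R a b c"
  using sat_axioms(12)[unfolded A15_i_def, simplified] by blast

text \<open>With coinciding points, inner transitivity turns \<open>R a a c\<close> into
  \<open>R a a a\<close>; symmetry reduces the other end to this.\<close>

lemma R_distinct: "R a b c \<Longrightarrow> a \<noteq> b \<and> b \<noteq> c"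
  using R_inner[of a a c a] R_inner[of c c a c] R_sym[of a b c] R_irrefl by blast

lemma betw_refl [simp]: "betw a a b" "betw a b b"
  by (simp_all add: nonstrict_of_def)

lemma betw_sym: "betw a b c \<Longrightarrow> betw c b a"
  using R_sym by (auto simp: nonstrict_of_def)

text \<open>For \<open>q = a\<close> the betweenness claim is trivial, and the segment is laid off
  from \<open>a\<close> with the help of another point, which exists because not all points are
  collinear.\<close>

lemma betw_construction: "\<exists>x. betw q a x \<and> E a x b c"
proof -
  have A4_i: "\<exists>x. betw q a x \<and> E a x b c" if "q \<noteq> a" for q
    using sat_axioms(4)[unfolded A4_i_def, simplified] that by blast
  show ?thesis
  proof (cases "q = a")
    case True
    have "\<exists>q. q \<noteq> a"
    proof (rule ccontr)
      assume "\<not> ?thesis"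
      then have "x = y" for x y :: 'a
        by metis
      then show False
        using sat_axioms(8)[unfolded A8_def, simplified] betw_refl by metis
    qed
    then obtain x where "E a x b c" using A4_i by blast
    with True show ?thesis by (intro exI[of _ x]) simp
  qed (rule A4_i)
qed

text \<open>When \<open>a\<close>, \<open>b\<close>, \<open>c\<close> are collinear and
  \<open>p\<close>, \<open>q\<close> are proper, the vertex between the other two serves as
  \<open>x\<close>; otherwise \<open>A7_i\<close> applies.\<close>

lemma betw_pasch:
  assumes "betw a p c" "betw b q c"
  shows "\<exists>x. betw p x b \<and> betw q x a"
proof -
  consider "p = a" | "p = c" | "q = b" | "q = c" | "R a p c" "R b q c"
    using assms by (auto simp: nonstrict_of_def)
  then show ?thesis
  proof cases
    case 1
    then show ?thesis by (intro exI[of _ a]) simp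
  next
    case 2
    with assms show ?thesis by (intro exI[of _ q]) (simp add: betw_sym)
  next
    case 3
    then show ?thesis by (intro exI[of _ b]) simp
  next
    case 4
    with assms show ?thesis by (intro exI[of _ p]) (simp add: betw_sym)
  next
    case 5
    consider "betw c a b" | "betw a c b" | "betw a b c" | "\<not> (betw c a b \<or> betw a c b \<or> betw a b c)" by blast
    then show ?thesis
    proof cases
      case 1
      have "betw b a p"
        using 1 5 R_inner[of b a c p] R_sym R_irrefl unfolding nonstrict_of_def by metis
      then show ?thesis by (intro exI[of _ a]) (simp add: betw_sym)
    next
      case 2
      have "betw b c p" "betw a c q"
        using 2 5 R_inner[of b c a p] R_inner[of a c b q] R_sym R_irrefl
        unfolding nonstrict_of_def by metis+
      then show ?thesis by (intro exI[of _ c]) (simp add: betw_sym)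
    next
      case 3
      have "betw a b q"
        using 3 5 R_inner[of a b c q] R_irrefl unfolding nonstrict_of_def by metis
      then show ?thesis by (intro exI[of _ b]) (simp add: betw_sym)
    next
      case 4
      have "betw b q c" using 5 by (simp add: nonstrict_of_def)
      with 4 5 show ?thesis
        using sat_axioms(7)[unfolded A7_i_def, simplified] by blast
    qed
  qed
qed

sublocale line_circle_geometry betw E
proof
  fix a b c d p q r s a' b' c' d'
  show "E a b b a"
    using sat_axioms(1)[unfolded A1_def, simplified] by blast
  show "E a b p q \<Longrightarrow> E a b r s \<Longrightarrow> E p q r s"
    using sat_axioms(2)[unfolded A2_def, simplified] by blast
  show "E a b c c \<Longrightarrow> a = b"
    using sat_axioms(3)[unfolded A3_def, simplified] by blast
  show "a \<noteq> b \<Longrightarrow> betw a b c \<Longrightarrow> betw a' b' c' \<Longrightarrow> E a b a' b' \<Longrightarrow> E b c b' c' \<Longrightarrow>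
      E a d a' d' \<Longrightarrow> E b d b' d' \<Longrightarrow> E c d c' d'"
    using sat_axioms(5)[unfolded A5_def, simplified] by blast
  show "betw a b a \<Longrightarrow> a = b"
    using R_irrefl by (auto simp: nonstrict_of_def)
next
  fix p u v a b
  assume "betw p u v \<or> betw u p v \<or> betw u v p" "u \<noteq> v" "betw a p b"
  then show "\<exists>y z. (betw y u v \<or> betw u y v \<or> betw u v y) \<and> (betw z u v \<or> betw u z v \<or> betw u v z) \<and>
        E a y a b \<and> E a z a b \<and> betw y p z \<and> (p \<noteq> b \<longrightarrow> y \<noteq> z)"
    using sat_axioms(13)[unfolded two_point_line_circle_def, simplified] by blast
qed (fact betw_construction betw_pasch)+

theorem classical_tarski_model:
  assumes "\<phi> \<in> classical_tarski"
  shows "sat (\<lambda>_. betw) E e \<phi>"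
proof -
  have "sat (both_betweenness R) E e A4" "sat (both_betweenness R) E e A6" "sat (both_betweenness R) E e A7"
    "sat (both_betweenness R) E e segment_circle"
    using betw_construction T_identity
    by (simp_all add: A4_def A6_def A7_def segment_circle_def) (blast intro: betw_pasch segment_circle)+
  with assms sat_axioms show ?thesis
    unfolding classical_tarski_def by (auto simp: sat_to_T[OF R_distinct])
qed

end

text \<open>The points of the term model must form a type, which cannot depend on a formula. The set below
  therefore refutes an unspecified counterexample to conservativity, and is arbitrary if there is none.\<close>

definition counterexample_henkin_set :: "strict fm set" where
  "counterexample_henkin_set = (SOME H. saturated H \<and> intuitionistic_tarski \<subseteq> H \<and>
     (\<exists>\<phi>. derives Classical classical_tarski (to_T \<phi>) \<and> (\<^bold>\<not> to_B \<phi>) \<in> H))"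

typedef point = "range (\<lambda>x. {y. (x \<^bold>= y) \<in> counterexample_henkin_set})"
  by blast

instance strict :: countable
  by countable_datatype

text \<open>A failure gives a saturated set whose term model satisfies the intuitionistic axioms,
  hence the classical ones, hence by soundness a formula that the set refutes.\<close>

theorem classical_conservativity:
  assumes "derives Classical classical_tarski (to_T \<phi>)"
  shows "derives Classical intuitionistic_tarski (to_B \<phi>)"
proof (rule ccontr)
  let ?H = counterexample_henkin_set
  assume "\<not> ?thesis"
  then have "consistent (insert (\<^bold>\<not> to_B \<phi>) intuitionistic_tarski)"
    by (simp add: consistent_insert_neg_iff)
  moreover have "infinite (- \<Union> (fv ` insert (\<^bold>\<not> to_B \<phi>) intuitionistic_tarski))"
  proof -
    \<comment> \<open>The axioms are closed, so \<open>\<phi>\<close> alone occupies variables and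
      infinitely many stay free for witnesses.\<close>
    have "fv \<psi> = {}" if "\<psi> \<in> intuitionistic_tarski" for \<psi>
      using that intuitionistic_tarski_closed by (intro fv_closed) blast
    then have "\<Union> (fv ` insert (\<^bold>\<not> to_B \<phi>) intuitionistic_tarski) = fv (\<^bold>\<not> to_B \<phi>)" by auto
    moreover have "infinite (- fv (\<^bold>\<not> to_B \<phi>))"
      using Diff_infinite_finite[OF finite_fv, of "UNIV :: nat set" "\<^bold>\<not> to_B \<phi>"]
      by (simp only: Compl_eq_Diff_UNIV infinite_UNIV_nat not_False_eq_True)
    ultimately show ?thesis by presburger
  qed
  ultimately have "\<exists>H. saturated H \<and> intuitionistic_tarski \<subseteq> H \<and>
      (\<exists>\<phi>. derives Classical classical_tarski (to_T \<phi>) \<and> (\<^bold>\<not> to_B \<phi>) \<in> H)"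
    using saturated_extension assms by (metis insert_subset)
  \<comment> \<open>The set fixed in advance may refute a counterexample \<open>\<psi>\<close> other
    than \<open>\<phi>\<close>.\<close>
  from someI_ex[OF this] obtain \<psi> where H: "saturated ?H" "intuitionistic_tarski \<subseteq> ?H"
    and \<psi>: "derives Classical classical_tarski (to_T \<psi>)" "(\<^bold>\<not> to_B \<psi>) \<in> ?H"
    unfolding counterexample_henkin_set_def[symmetric] by blast
  define cls where "cls x = Abs_point {y. (x \<^bold>= y) \<in> ?H}" for x
  have "surj cls"
    unfolding surj_def cls_def by (metis (no_types, lifting) Abs_point_cases imageE)
  moreover have cls_eq: "cls x = cls y \<longleftrightarrow> (x \<^bold>= y) \<in> ?H" for x y
  proof -
    have "cls x = cls y \<longleftrightarrow> {z. (x \<^bold>= z) \<in> ?H} = {z. (y \<^bold>= z) \<in> ?H}"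
      unfolding cls_def by (rule Abs_point_inject) auto
    also have "\<dots> \<longleftrightarrow> (x \<^bold>= y) \<in> ?H"
      using saturated_Eql_refl[OF H(1)] saturated_Eql_sym[OF H(1)] saturated_Eql_trans[OF H(1)]
      by blast
    finally show ?thesis .
  qed
  ultimately obtain I C where truth: "sat I C (cls \<circ> f) \<chi> \<longleftrightarrow> ren f \<chi> \<in> ?H" for f \<chi>
    using truth_lemma[OF H(1), of cls] by blast
  define R where "R = I StrictOnly"
  have I: "I = (\<lambda>_. R)"
    unfolding R_def by (rule ext) (metis strict.exhaust)
  interpret intuitionistic_tarski_model R C
  proof
    fix \<chi> and e :: "nat \<Rightarrow> point"
    assume \<chi>: "\<chi> \<in> intuitionistic_tarski"
    have "\<forall>n. \<exists>m. e n = cls m" using \<open>surj cls\<close> by (auto simp: surj_def)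
    then obtain f where "\<forall>n. e n = cls (f n)"
      using choice by metis
    then have "e = cls \<circ> f" by (simp add: fun_eq_iff)
    with truth[of f \<chi>] \<chi> H(2) intuitionistic_tarski_closed[OF \<chi>, of f] show "sat (\<lambda>_. R) C e \<chi>"
      by (auto simp: I)
  qed
  have "sat (\<lambda>_. betw) C (cls \<circ> (\<lambda>n. n)) (to_T \<psi>)"
    using soundness[OF \<psi>(1)] classical_tarski_model by blast
  then have "sat I C (cls \<circ> (\<lambda>n. n)) (to_B \<psi>)"
    by (simp only: I sat_to_B sat_to_T[OF R_distinct])
  then have "to_B \<psi> \<in> ?H"
    by (simp only: truth ren_id)
  with \<psi>(2) show False
    by (simp add: saturated_neg_iff[OF H(1)])
qed

section \<open>Return to intuitionistic logic\<close>

lemma negative_to_B: "negative \<phi> \<Longrightarrow> negative (to_B \<phi>)"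
  unfolding to_B_def by (induction \<phi>) (simp_all split: betweenness.split)

text \<open>The equation as a premise lets the simplifier compute the instance.\<close>

lemma derives_UniE: "derives L \<Gamma> (Uni \<phi>) \<Longrightarrow> inst x \<phi> = \<psi> \<Longrightarrow> derives L \<Gamma> \<psi>"
  using derives.UniE by blast

lemma to_B_stability:
  "to_B stability_Eql = Uni (Uni (\<^bold>\<not> \<^bold>\<not> (Suc 0 \<^bold>= 0) \<^bold>\<longrightarrow> Suc 0 \<^bold>= 0))"
  "to_B stability_B = Uni (Uni (Uni (\<^bold>\<not> \<^bold>\<not> Betw StrictOnly (Suc (Suc 0)) (Suc 0) 0 \<^bold>\<longrightarrow>
     Betw StrictOnly (Suc (Suc 0)) (Suc 0) 0)))"
  "to_B stability_Cong = Uni (Uni (Uni (Uni (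
     \<^bold>\<not> \<^bold>\<not> Cong (Suc (Suc (Suc 0))) (Suc (Suc 0)) (Suc 0) 0 \<^bold>\<longrightarrow>
     Cong (Suc (Suc (Suc 0))) (Suc (Suc 0)) (Suc 0) 0))))"
  by (simp_all add: stability_Eql_def stability_B_def stability_Cong_def to_B_def all_vars_def
      bind_def eval_nat_numeral)

lemma stable_atoms_intuitionistic_tarski: "stable_atoms intuitionistic_tarski"
proof -
  have ax: "derives Intuitionistic intuitionistic_tarski (to_B stability_Eql)"
    "derives Intuitionistic intuitionistic_tarski (to_B stability_B)"
    "derives Intuitionistic intuitionistic_tarski (to_B stability_Cong)"
    by (rule derives.Hyp; simp add: intuitionistic_tarski_def)+
  have "derives Intuitionistic intuitionistic_tarski (\<^bold>\<not> \<^bold>\<not> (x \<^bold>= y) \<^bold>\<longrightarrow> x \<^bold>= y)" for x y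
  proof -
    \<comment> \<open>Quantifiers are instantiated from the outside in; a variable already inserted
      carries one \<open>Suc\<close> for each quantifier left.\<close>
    have "derives Intuitionistic intuitionistic_tarski (Uni (\<^bold>\<not> \<^bold>\<not> (Suc x \<^bold>= 0) \<^bold>\<longrightarrow> Suc x \<^bold>= 0))"
      by (rule derives_UniE[OF ax(1)[unfolded to_B_stability], of x]) (simp add: inst_def)
    then show ?thesis
      by (rule derives_UniE[of _ _ _ y]) (simp add: inst_def)
  qed
  moreover have "derives Intuitionistic intuitionistic_tarski
      (\<^bold>\<not> \<^bold>\<not> Betw r x y z \<^bold>\<longrightarrow> Betw r x y z)" for r x y z
  proof -
    let ?\<psi> = "\<lambda>x y z. \<^bold>\<not> \<^bold>\<not> Betw StrictOnly x y z \<^bold>\<longrightarrow> Betw StrictOnly x y z"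
    have "derives Intuitionistic intuitionistic_tarski (Uni (Uni (?\<psi> (Suc (Suc x)) (Suc 0) 0)))"
      by (rule derives_UniE[OF ax(2)[unfolded to_B_stability], of x]) (simp add: inst_def)
    then have "derives Intuitionistic intuitionistic_tarski (Uni (?\<psi> (Suc x) (Suc y) 0))"
      by (rule derives_UniE[of _ _ _ y]) (simp add: inst_def)
    then have "derives Intuitionistic intuitionistic_tarski (?\<psi> x y z)"
      by (rule derives_UniE[of _ _ _ z]) (simp add: inst_def)
    then show ?thesis by (cases r) simp
  qed
  moreover have "derives Intuitionistic intuitionistic_tarski
      (\<^bold>\<not> \<^bold>\<not> Cong x y z w \<^bold>\<longrightarrow> Cong x y z w)" for x y z w
  proof -
    let ?\<psi> = "\<lambda>x y z w. \<^bold>\<not> \<^bold>\<not> Cong x y z w \<^bold>\<longrightarrow> Cong x y z w"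
    have "derives Intuitionistic intuitionistic_tarski
        (Uni (Uni (Uni (?\<psi> (Suc (Suc (Suc x))) (Suc (Suc 0)) (Suc 0) 0))))"
      by (rule derives_UniE[OF ax(3)[unfolded to_B_stability], of x]) (simp add: inst_def)
    then have "derives Intuitionistic intuitionistic_tarski
        (Uni (Uni (?\<psi> (Suc (Suc x)) (Suc (Suc y)) (Suc 0) 0)))"
      by (rule derives_UniE[of _ _ _ y]) (simp add: inst_def)
    then have "derives Intuitionistic intuitionistic_tarski (Uni (?\<psi> (Suc x) (Suc y) (Suc z) 0))"
      by (rule derives_UniE[of _ _ _ z]) (simp add: inst_def)
    then show ?thesis
      by (rule derives_UniE[of _ _ _ w]) (simp add: inst_def)
  qed
  ultimately show ?thesis
    unfolding stable_atoms_def using intuitionistic_tarski_closed by blast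
qed

text \<open>Existentials occur in the axioms only outside the premises of implications, and
  unfolding \<open>T\<close> introduces none.\<close>

lemma intuitionistic_tarski_gg:
  assumes "\<phi> \<in> intuitionistic_tarski"
  shows "derives L intuitionistic_tarski (gg \<phi>)"
proof (rule derives_gg_of_derives)
  show "gg_provable_form \<phi>"
    using assms unfolding intuitionistic_tarski_def axiom_defs
    by (auto simp: to_B_def all_vars_def ex_vars_def bind_def)
  show "derives L intuitionistic_tarski \<phi>"
    using assms by (rule derives.Hyp)
qed

theorem corollary12p3:
  fixes \<phi> :: "betweenness fm"
  assumes "negative \<phi>"
    and "derives Classical classical_tarski (to_T \<phi>)"
  shows "derives Intuitionistic intuitionistic_tarski (to_B \<phi>)"
proof -
  have "derives Intuitionistic (gg ` intuitionistic_tarski \<union> intuitionistic_tarski) (gg (to_B \<phi>))"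
    using stable_atoms_intuitionistic_tarski classical_conservativity[OF assms(2)] by (rule derives_gg)
  \<comment> \<open>The translated axioms are cut out, being derivable from the axioms
    themselves.\<close>
  then have "derives Intuitionistic intuitionistic_tarski (gg (to_B \<phi>))"
    by (rule derives_cut) (auto intro: derives.Hyp intuitionistic_tarski_gg)
  then show ?thesis
    using gg_negative[OF negative_to_B[OF assms(1)]] by simp
qed

end
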